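(* Let $n,m\ge 1$ and, for $h=1,\dots,n+m$, let $K_h=[a_h,b_h]$ and let $f_h\colon K_h\to[0,\infty)$ be Lipschitz continuous and concave with $f_h(a_h)=f_h(b_h)=0$, and such that $\sum_{i=1}^n f_i(0)-\sum_{j=n+1}^{n+m}f_j(0)=0$. Let $\hat\eta_h\colon\mathbb R\to\mathbb R$ be convex and let $\Pi^M$, $M\in\mathbb R$, be priority functions for $(\hat\eta_h)_h$. Let $\rho^s=(\rho^s_1,\dots,\rho^s_{n+m})$ with $\rho_h^s\in K_h$ satisfy $\mathcal{RP}(\rho^s)=\rho^s$ for $s=1,2$. Then $$\sum_{i=1}^nG_i(\rho_i^1,\rho_i^2)-\sum_{j=n+1}^{n+m}G_j(\rho_j^1,\rho_j^2)\ge0,$$ where $G_h(\rho,k)=\operatorname{sgn}(\rho-k)\,(f_h(\rho)-f_h(k))$ is the Kružkov entropy flux.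
   Context: **Network.** Roads $h=i\in\{1,\dots,n\}$ are incoming, with $\Omega_h=(-\infty,0)$; roads $h=j\in\{n+1,\dots,n+m\}$ are outgoing, with $\Omega_h=(0,\infty)$; the junction is $x=0$. Each $f_h$ is extended by $0$ to $\mathbb R\setminus K_h$. For derivatives of convex/concave functions, monotone representatives are used. **Priority functions.** With the convention $\hat\eta_h'(a_h-)=-\infty$, $\hat\eta_h'(b_h+)=+\infty$, priority functions are families $\Pi^M=(\Pi^M_1,\dots,\Pi^M_{n+m})$, $M\in\mathbb R$, such that each $\Pi_h^M\colon[0,1]\to\{\rho\in K_h:\hat\eta_h'(\rho-)\le M\le\hat\eta_h'(\rho+)\}$ is non-decreasing and surjective. **Generalized Riemann problem and Riemann solver.** Given constants $\rho_{0,h}\in K_h$, choose $M\in\mathbb R$, $z\in[0,1]$ (the same for all $h$) and $\hat\rho_h=\Pi^M_h(z)$ such that, if $\rho_h$ is the weak entropy solution on $(0,\infty)\times\mathbb R$ of the standard Riemann problem $\partial_t\rho_h+\partial_xf_h(\rho_h)=0$ with $\rho_h(0,x)=\rho_{0,h}$ for $x\in\Omega_h$ and $\rho_h(0,x)=\hat\rho_h$ for $x\notin\Omega_h$, then $\sum_{i=1}^nf_i(\rho_i(t,0))-\sum_{j=n+1}^{n+m}f_j(\rho_j(t,0))=0$ (the flux of $\rho_h$ at $x=0$ is the same from both sides). The solution to the generalized Riemann problem is given by the restrictions of $\rho_h$ to $x\in\Omega_h$ (it exists and is unique), and the Riemann solver is $\mathcal{RP}(\rho_0)=(\rho_1(t,0-),\dots,\rho_n(t,0-),\rho_{n+1}(t,0+),\dots,\rho_{n+m}(t,0+))$.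 *)

theory Defs
  imports "HOL-Analysis.Analysis"
begin

text \<open>
  Functions of time and space are curried, \<open>u t x\<close>. A test function is the restriction to
  \<open>t \<ge> 0\<close> of a continuously differentiable, compactly supported function on the plane; it need not
  vanish at \<open>t = 0\<close>, which is how the initial datum enters. \<open>\<phi>t\<close> and \<open>\<phi>x\<close> are its partial
  derivatives.
\<close>

definition test_function ::
  "(real \<Rightarrow> real \<Rightarrow> real) \<Rightarrow> (real \<Rightarrow> real \<Rightarrow> real) \<Rightarrow> (real \<Rightarrow> real \<Rightarrow> real) \<Rightarrow> bool" where
  "test_function \<phi> \<phi>t \<phi>x \<longleftrightarrow>
     (\<forall>t x. ((\<lambda>s. \<phi> s x) has_real_derivative \<phi>t t x) (at t)) \<and>
     (\<forall>t x. ((\<lambda>y. \<phi> t y) has_real_derivative \<phi>x t x) (at x)) \<and>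
     continuous_on UNIV (\<lambda>(t, x). \<phi>t t x) \<and>
     continuous_on UNIV (\<lambda>(t, x). \<phi>x t x) \<and>
     compact (closure {(t, x). \<phi> t x \<noteq> 0})"

definition kruzkov_flux :: "(real \<Rightarrow> real) \<Rightarrow> real \<Rightarrow> real \<Rightarrow> real" where
  "kruzkov_flux f \<rho> k = sgn (\<rho> - k) * (f \<rho> - f k)"

definition weak_solution ::
  "(real \<Rightarrow> real) \<Rightarrow> (real \<Rightarrow> real) \<Rightarrow> (real \<Rightarrow> real \<Rightarrow> real) \<Rightarrow> bool" where
  "weak_solution f u0 u \<longleftrightarrow>
     (\<forall>\<phi> \<phi>t \<phi>x. test_function \<phi> \<phi>t \<phi>x \<longrightarrow>
        (LINT (t, x):{0<..} \<times> UNIV|lborel. u t x * \<phi>t t x + f (u t x) * \<phi>x t x)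
        + (LINT x|lborel. u0 x * \<phi> 0 x) = 0)"

definition entropy_condition ::
  "(real \<Rightarrow> real) \<Rightarrow> (real \<Rightarrow> real) \<Rightarrow> (real \<Rightarrow> real \<Rightarrow> real) \<Rightarrow> bool" where
  "entropy_condition f u0 u \<longleftrightarrow>
     (\<forall>k \<phi> \<phi>t \<phi>x. test_function \<phi> \<phi>t \<phi>x \<and> (\<forall>t x. 0 \<le> \<phi> t x) \<longrightarrow>
        0 \<le> (LINT (t, x):{0<..} \<times> UNIV|lborel.
               \<bar>u t x - k\<bar> * \<phi>t t x + kruzkov_flux f (u t x) k * \<phi>x t x)
             + (LINT x|lborel. \<bar>u0 x - k\<bar> * \<phi> 0 x))"

definition weak_entropy_solution ::
  "(real \<Rightarrow> real) \<Rightarrow> (real \<Rightarrow> real) \<Rightarrow> (real \<Rightarrow> real \<Rightarrow> real) \<Rightarrow> bool" where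
  "weak_entropy_solution f u0 u \<longleftrightarrow>
     set_borel_measurable lborel ({0<..} \<times> UNIV) (\<lambda>(t, x). u t x) \<and>
     (\<exists>B. AE (t, x) in lborel. 0 < t \<longrightarrow> \<bar>u t x\<bar> \<le> B) \<and>
     weak_solution f u0 u \<and> entropy_condition f u0 u"

text \<open>
  One-sided derivatives of a convex function, with the convention that the left derivative at the
  left end point of \<open>[a, b]\<close> is \<open>-\<infinity>\<close> and the right derivative at the right end point is \<open>\<infinity>\<close>.
\<close>

definition left_deriv :: "real \<Rightarrow> (real \<Rightarrow> real) \<Rightarrow> real \<Rightarrow> ereal" where
  "left_deriv a \<eta> \<rho> = (if \<rho> = a then -\<infinity> else ereal (vector_derivative \<eta> (at_left \<rho>)))"

definition right_deriv :: "real \<Rightarrow> (real \<Rightarrow> real) \<Rightarrow> real \<Rightarrow> ereal" where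
  "right_deriv b \<eta> \<rho> = (if \<rho> = b then \<infinity> else ereal (vector_derivative \<eta> (at_right \<rho>)))"

definition priority_functions ::
  "nat \<Rightarrow> (nat \<Rightarrow> real) \<Rightarrow> (nat \<Rightarrow> real) \<Rightarrow> (nat \<Rightarrow> real \<Rightarrow> real) \<Rightarrow>
   (real \<Rightarrow> nat \<Rightarrow> real \<Rightarrow> real) \<Rightarrow> bool" where
  "priority_functions N a b \<eta> P \<longleftrightarrow>
     (\<forall>M. \<forall>h\<in>{1..N}.
        mono_on {0..1} (P M h) \<and>
        P M h ` {0..1} =
          {\<rho> \<in> {a h..b h}. left_deriv (a h) (\<eta> h) \<rho> \<le> ereal M \<and>
                           ereal M \<le> right_deriv (b h) (\<eta> h) \<rho>})"

definition road :: "nat \<Rightarrow> nat \<Rightarrow> real set" where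
  "road n h = (if h \<le> n then {..<0} else {0<..})"

text \<open>
  The graph of the Riemann solver: \<open>r\<close> is the value of the solver at \<open>\<rho>0\<close>. The weak entropy
  solutions \<open>u h\<close> are determined only up to null sets; the traces are those of a representative
  having one-sided limits at \<open>x = 0\<close>, and they are constant in \<open>t\<close> because the solutions are
  self-similar. Since the flux of \<open>u h\<close> at \<open>x = 0\<close> is the same from both sides, it equals
  \<open>f h (r h)\<close>.
\<close>

definition riemann_solver ::
  "nat \<Rightarrow> nat \<Rightarrow> (nat \<Rightarrow> real \<Rightarrow> real) \<Rightarrow> (real \<Rightarrow> nat \<Rightarrow> real \<Rightarrow> real) \<Rightarrow>
   (nat \<Rightarrow> real) \<Rightarrow> (nat \<Rightarrow> real) \<Rightarrow> bool" where
  "riemann_solver n m f P \<rho>0 r \<longleftrightarrow>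
     (\<exists>M. \<exists>z\<in>{0..1}. \<exists>u.
        (\<forall>h\<in>{1..n+m}.
           weak_entropy_solution (f h) (\<lambda>x. if x \<in> road n h then \<rho>0 h else P M h z) (u h) \<and>
           (\<forall>t>0. (u h t \<longlongrightarrow> r h) (at 0 within road n h))) \<and>
        (\<Sum>i=1..n. f i (r i)) - (\<Sum>j=n+1..n+m. f j (r j)) = 0)"

end

theory Submission
  imports Defs
begin

text \<open>
  Write \<open>\<sigma> = 1\<close> on incoming and \<open>\<sigma> = -1\<close> on outgoing roads, so that road \<open>h\<close> is \<open>{x. \<sigma> x < 0}\<close>, and
  put \<open>g = \<sigma> f\<close>. If \<open>\<rho>\<close> is stationary and \<open>r = \<Pi>\<^sup>M(z)\<close> is the value prescribed beyond the junction,
  then no wave of the Riemann problem enters the road, which amounts to \<open>sgn (\<rho> - k) (g \<rho> - g k) \<ge> 0\<close>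
  for every \<open>k\<close> between \<open>\<rho>\<close> and \<open>r\<close>; that is, \<open>f \<rho>\<close> is the Godunov flux of the two states. To see this,
  test the entropy \<open>(v - k)\<^sup>+\<close> or \<open>(v - k)\<^sup>-\<close>, whichever vanishes at \<open>r\<close>, with a cutoff of the
  backward light cone of the junction which jumps from 0 to 1 inside the road at distance \<open>\<delta> \<rightarrow> 0\<close>.

  The states prescribed for \<open>\<rho>\<^sup>1\<close> and \<open>\<rho>\<^sup>2\<close> are ordered in the same way on all roads, because the
  pairs \<open>(M, z)\<close> are ordered lexicographically. If \<open>r\<^sup>1 \<le> r\<^sup>2\<close>, monotonicity of the Godunov flux gives
  \<open>g \<rho>\<^sup>1 \<ge> g \<rho>\<^sup>2\<close> on the roads with \<open>\<rho>\<^sup>1 > \<rho>\<^sup>2\<close>, so that \<open>\<sigma> G(\<rho>\<^sup>1, \<rho>\<^sup>2) \<ge> g \<rho>\<^sup>2 - g \<rho>\<^sup>1\<close> on every road, and the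
  right-hand sides sum to zero by conservation at the junction.
\<close>

subsection \<open>One-sided derivatives and priority functions\<close>

text \<open>By convexity the slope \<open>s z\<close> from \<open>x\<close> to \<open>z\<close> is
  nondecreasing in \<open>z\<close> and bounded below by the slope over \<open>[x - 1, x]\<close>.
  Its infimum over \<open>z > x\<close> is therefore its limit at \<open>x\<close>.\<close>

lemma convex_on_right_deriv:
  fixes \<eta> :: "real \<Rightarrow> real"
  assumes "convex_on UNIV \<eta>"
  obtains D where "(\<eta> has_real_derivative D) (at_right x)"
    and "\<And>y. x < y \<Longrightarrow> D \<le> (\<eta> y - \<eta> x) / (y - x)"
proof -
  define s where "s z = (\<eta> z - \<eta> x) / (z - x)" for z
  define D where "D = Inf (s ` {x<..})"
  have slope: "s z \<le> s z'" if "x < z" "z \<le> z'" for z z'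
  proof (cases "z = z'")
    case False
    then show ?thesis
      using convex_on_slope_le(1)[OF assms(1), of x z' z] that
      by (simp add: s_def)  (smt (verit) minus_divide_divide)
  qed auto
  have below: "(\<eta> x - \<eta> (x - 1)) \<le> s z" if "x < z" for z
    using convex_on_slope_le[OF assms(1), of "x - 1" z x] that
    by (simp add: s_def) (smt (verit) minus_divide_divide)
  have bdd: "bdd_below (s ` {x<..})"
    using below by (auto intro!: bdd_belowI2)
  have D_le: "D \<le> s z" if "x < z" for z
    unfolding D_def using that by (intro cInf_lower bdd) auto
  have "(s \<longlongrightarrow> D) (at_right x)"
  proof (rule decreasing_tendsto)
    show "\<forall>\<^sub>F z in at_right x. D \<le> s z"
      using D_le by (auto simp: eventually_at_filter)
    fix c assume "D < c"
    then obtain w where w: "x < w" "s w < c"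
      unfolding D_def using cInf_lessD[of "s ` {x<..}" c] by auto
    have "\<forall>\<^sub>F z in at_right x. z < w"
      using w(1) by (rule eventually_at_right_real[THEN eventually_mono]) auto
    moreover have "\<forall>\<^sub>F z in at_right x. x < z"
      by (auto simp: eventually_at_filter)
    ultimately show "\<forall>\<^sub>F z in at_right x. s z < c"
      by eventually_elim (meson slope w(2) less_imp_le order_le_less_trans)
  qed
  then have "(\<eta> has_real_derivative D) (at_right x)"
    unfolding s_def has_field_derivative_iff .
  then show thesis
    using that D_le by (simp add: s_def)
qed

lemma has_real_derivative_at_left_minus:
  fixes \<eta> :: "real \<Rightarrow> real"
  shows "(\<eta> has_real_derivative D) (at_left y) \<longleftrightarrow>
    ((\<lambda>x. \<eta> (- x)) has_real_derivative - D) (at_right (- y))"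
proof -
  have "(\<eta> has_real_derivative D) (at_left y) \<longleftrightarrow>
      ((\<lambda>z. (\<eta> z - \<eta> y) / (z - y)) \<longlongrightarrow> D) (at_left y)"
    by (simp add: has_field_derivative_iff)
  also have "\<dots> \<longleftrightarrow> ((\<lambda>z. - ((\<eta> (- z) - \<eta> y) / (- z - y))) \<longlongrightarrow> - D) (at_right (- y))"
    by (simp add: at_left_minus filterlim_filtermap tendsto_minus_cancel_left[symmetric])
  also have "(\<lambda>z. - ((\<eta> (- z) - \<eta> y) / (- z - y))) = (\<lambda>z. (\<eta> (- z) - \<eta> (- (- y))) / (z - (- y)))"
    by (simp add: fun_eq_iff) (smt (verit) minus_divide_divide minus_divide_left)
  finally show ?thesis
    by (simp add: has_field_derivative_iff)
qed


text \<open>Reflection in the origin preserves convexity and turns left difference quotients into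
  negated right ones.\<close>

lemma convex_on_left_deriv:
  fixes \<eta> :: "real \<Rightarrow> real"
  assumes "convex_on UNIV \<eta>"
  obtains D where "(\<eta> has_real_derivative D) (at_left y)"
    and "\<And>x. x < y \<Longrightarrow> (\<eta> y - \<eta> x) / (y - x) \<le> D"
proof -
  have "convex_on UNIV (\<lambda>x. \<eta> (- x))"
  proof (rule convex_onI)
    fix t x y :: real assume "0 < t" "t < 1"
    then show "\<eta> (- ((1 - t) *\<^sub>R x + t *\<^sub>R y)) \<le> (1 - t) * \<eta> (- x) + t * \<eta> (- y)"
      using convex_onD[OF assms, of t "- x" "- y"] by (simp add: algebra_simps)
  qed simp
  from convex_on_right_deriv[OF this, of "- y"] obtain D
    where D: "((\<lambda>x. \<eta> (- x)) has_real_derivative D) (at_right (- y))"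
      and le: "\<And>x. - y < x \<Longrightarrow> D \<le> (\<eta> (- x) - \<eta> (- (- y))) / (x - (- y))"
    by blast
  have "(\<eta> y - \<eta> x) / (y - x) \<le> - D" if "x < y" for x
    using le[of "- x"] that by (simp add: field_simps)
  moreover have "(\<eta> has_real_derivative - D) (at_left y)"
    using D by (simp add: has_real_derivative_at_left_minus)
  ultimately show thesis
    using that by blast
qed

text \<open>Both derivatives are compared with the slope of the chord from \<open>x\<close> to
  \<open>y\<close>. The bounds \<open>x < b\<close> and \<open>a < y\<close> exclude the end points
  at which the convention makes them infinite.\<close>

lemma right_deriv_le_left_deriv:
  assumes "convex_on UNIV \<eta>" and "x < y" and "x < b" and "a < y"
  shows "right_deriv b \<eta> x \<le> left_deriv a \<eta> y"
proof -
  obtain D where D: "(\<eta> has_real_derivative D) (at_right x)"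
      "\<And>y. x < y \<Longrightarrow> D \<le> (\<eta> y - \<eta> x) / (y - x)"
    using convex_on_right_deriv[OF assms(1)] by blast
  obtain D' where D': "(\<eta> has_real_derivative D') (at_left y)"
      "\<And>x. x < y \<Longrightarrow> (\<eta> y - \<eta> x) / (y - x) \<le> D'"
    using convex_on_left_deriv[OF assms(1)] by blast
  have "vector_derivative \<eta> (at_right x) = D"
    using D(1) by (intro vector_derivative_within)
      (auto simp: has_real_derivative_iff_has_vector_derivative trivial_limit_at_right_real)
  moreover have "vector_derivative \<eta> (at_left y) = D'"
    using D'(1) by (intro vector_derivative_within)
      (auto simp: has_real_derivative_iff_has_vector_derivative trivial_limit_at_left_real)
  moreover have "D \<le> D'"
    using D(2)[of y] D'(2)[of x] assms(2) by linarith
  ultimately show ?thesis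
    using assms by (simp add: right_deriv_def left_deriv_def)
qed

text \<open>For equal \<open>M\<close> this is monotonicity in \<open>z\<close>. For
  \<open>M < M'\<close>, a value at \<open>M'\<close> strictly below the one at \<open>M\<close>
  would give \<open>M'\<close> \<le> \<open>right_deriv\<close> \<le> \<open>left_deriv\<close>
  \<le> \<open>M\<close> by convexity.\<close>

lemma priority_functions_mono:
  assumes P: "priority_functions N a b \<eta> P"
    and convex: "\<And>h. h \<in> {1..N} \<Longrightarrow> convex_on UNIV (\<eta> h)"
    and z: "z \<in> {0..1}" "z' \<in> {0..1}"
    and less: "M < M' \<or> M = M' \<and> z \<le> z'"
    and h: "h \<in> {1..N}"
  shows "P M h z \<le> P M' h z'"
proof (cases "M = M'")
  case True
  then show ?thesis
    using P h z less by (auto simp: priority_functions_def mono_on_def)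
next
  case False
  then have "M < M'"
    using less by auto
  let ?r = "P M h z" and ?r' = "P M' h z'"
  have im: "P M h ` {0..1} = {\<rho> \<in> {a h..b h}. left_deriv (a h) (\<eta> h) \<rho> \<le> ereal M \<and>
      ereal M \<le> right_deriv (b h) (\<eta> h) \<rho>}" for M
    using P h by (auto simp: priority_functions_def)
  have r: "?r \<in> {a h..b h}" "left_deriv (a h) (\<eta> h) ?r \<le> ereal M"
    and r': "?r' \<in> {a h..b h}" "ereal M' \<le> right_deriv (b h) (\<eta> h) ?r'"
    using im[of M] im[of M'] z by blast+
  show ?thesis
  proof (rule ccontr)
    assume "\<not> ?thesis"
    then have "right_deriv (b h) (\<eta> h) ?r' \<le> left_deriv (a h) (\<eta> h) ?r"
      using r(1) r'(1) by (intro right_deriv_le_left_deriv convex h) auto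
    then have "ereal M' \<le> ereal M"
      using r(2) r'(2) by (meson order_trans)
    then show False
      using \<open>M < M'\<close> by simp
  qed
qed

subsection \<open>Test functions\<close>

lemma DERIV_zero_on_open:
  fixes g :: "real \<Rightarrow> real"
  assumes "(g has_real_derivative D) (at s)" and "open S" and "s \<in> S"
    and "\<And>r. r \<in> S \<Longrightarrow> g r = 0"
  shows "D = 0"
proof -
  have "((\<lambda>_. 0) has_real_derivative D) (at s)"
    using has_field_derivative_transform_within_open[OF assms(1-3)] assms(4) by auto
  then show ?thesis
    using DERIV_unique DERIV_const by blast
qed

text \<open>The bound on the support of \<open>\<phi>\<close> serves both derivatives, because
  \<open>\<phi>\<close> vanishes near every point beyond it. Enlarging the radius by one turns the
  strict inequalities into weak ones.\<close>

lemma test_function_support: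
  assumes "test_function \<phi> \<phi>t \<phi>x"
  obtains R where "0 < R"
    and "\<And>t x. R \<le> \<bar>t\<bar> \<or> R \<le> \<bar>x\<bar> \<Longrightarrow> \<phi> t x = 0 \<and> \<phi>t t x = 0 \<and> \<phi>x t x = 0"
proof -
  have "bounded {(t, x). \<phi> t x \<noteq> 0}"
    using assms bounded_subset[OF compact_imp_bounded closure_subset]
    by (auto simp: test_function_def)
  then obtain r where r: "0 < r" "\<And>z. z \<in> {(t, x). \<phi> t x \<noteq> 0} \<Longrightarrow> norm z \<le> r"
    by (auto simp: bounded_pos)
  have zero: "\<phi> t x = 0" if "r < \<bar>t\<bar> \<or> r < \<bar>x\<bar>" for t x
  proof (rule ccontr)
    assume "\<phi> t x \<noteq> 0"
    then have "norm (t, x) \<le> r"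
      using r(2) by auto
    moreover have "\<bar>t\<bar> \<le> norm (t, x)" "\<bar>x\<bar> \<le> norm (t, x)"
      using norm_fst_le[of t x] norm_snd_le[of x t] by simp_all
    ultimately show False
      using that by linarith
  qed
  have opn: "open {s. r < \<bar>s\<bar>}" if "r < \<bar>s\<bar>" for s :: real
    by (intro open_Collect_less continuous_intros)
  have t: "((\<lambda>s. \<phi> s x) has_real_derivative \<phi>t t x) (at t)"
    and x: "((\<lambda>y. \<phi> t y) has_real_derivative \<phi>x t x) (at x)" for t x
    using assms by (auto simp: test_function_def)
  have "\<phi>t t x = 0 \<and> \<phi>x t x = 0" if "r < \<bar>t\<bar> \<or> r < \<bar>x\<bar>" for t x
    using that
  proof
    assume "r < \<bar>t\<bar>"
    then show ?thesis
      using DERIV_zero_on_open[OF t opn] DERIV_zero_on_open[OF x open_UNIV] zero by auto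
  next
    assume "r < \<bar>x\<bar>"
    then show ?thesis
      using DERIV_zero_on_open[OF x opn] DERIV_zero_on_open[OF t open_UNIV] zero by auto
  qed
  with zero have "\<phi> t x = 0 \<and> \<phi>t t x = 0 \<and> \<phi>x t x = 0" if "r + 1 \<le> \<bar>t\<bar> \<or> r + 1 \<le> \<bar>x\<bar>" for t x
    using that by (metis less_add_one less_le_trans)
  then show thesis
    using r(1) that[of "r + 1"] by simp
qed

lemma integrable_compact_support:
  fixes h :: "'a::euclidean_space \<Rightarrow> real"
  assumes "continuous_on UNIV h" and "compact K" and "\<And>z. z \<notin> K \<Longrightarrow> h z = 0"
  shows "integrable lborel h"
proof -
  have "integrable lborel (\<lambda>z. indicator K z *\<^sub>R h z)"
    by (rule borel_integrable_compact[OF assms(2) continuous_on_subset[OF assms(1) subset_UNIV]])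
  also have "(\<lambda>z. indicator K z *\<^sub>R h z) = h"
    using assms(3) by (auto simp: fun_eq_iff indicator_def)
  finally show ?thesis .
qed

lemma test_function_integrable:
  assumes "test_function \<phi> \<phi>t \<phi>x"
  shows "integrable lborel (\<lambda>(t, x). \<phi>t t x)" and "integrable lborel (\<lambda>(t, x). \<phi>x t x)"
    and "integrable lborel (\<phi> t)"
proof -
  obtain R where "0 < R"
    and R: "\<And>t x. R \<le> \<bar>t\<bar> \<or> R \<le> \<bar>x\<bar> \<Longrightarrow> \<phi> t x = 0 \<and> \<phi>t t x = 0 \<and> \<phi>x t x = 0"
    using test_function_support[OF assms] by blast
  have K: "compact ({-R..R} \<times> {-R..R})"
    by (intro compact_Times) auto
  have out: "\<phi>t (fst z) (snd z) = 0 \<and> \<phi>x (fst z) (snd z) = 0" if "z \<notin> {-R..R} \<times> {-R..R}" for z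
  proof -
    have "R \<le> \<bar>fst z\<bar> \<or> R \<le> \<bar>snd z\<bar>"
      using that by (auto simp: mem_Times_iff)
    with R show ?thesis by blast
  qed
  have "continuous_on UNIV (\<lambda>(t, x). \<phi>t t x)" "continuous_on UNIV (\<lambda>(t, x). \<phi>x t x)"
    using assms by (simp_all add: test_function_def)
  from this[THEN integrable_compact_support[OF _ K]]
  show "integrable lborel (\<lambda>(t, x). \<phi>t t x)" "integrable lborel (\<lambda>(t, x). \<phi>x t x)"
    using out by (simp_all add: split_def)
  have "continuous_on UNIV (\<phi> t)"
    using assms unfolding test_function_def
    by (meson DERIV_isCont continuous_at_imp_continuous_on)
  then show "integrable lborel (\<phi> t)"
  proof (rule integrable_compact_support[OF _ compact_Icc])
    show "\<phi> t x = 0" if "x \<notin> {-R..R}" for x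
    proof -
      have "R \<le> \<bar>x\<bar>"
        using that by auto
      with R show ?thesis by blast
    qed
  qed
qed

section \<open>Integrals against test functions on the half plane\<close>

lemma integrable_mult_AE_bounded:
  fixes g h :: "_ \<Rightarrow> real"
  assumes "integrable M h" and [measurable]: "g \<in> borel_measurable M"
    and "AE z in M. \<bar>g z\<bar> \<le> C"
  shows "integrable M (\<lambda>z. g z * h z)"
proof (rule Bochner_Integration.integrable_bound)
  show "integrable M (\<lambda>z. C * h z)"
    using assms(1) by simp
  have [measurable]: "h \<in> borel_measurable M"
    using assms(1) by simp
  show "(\<lambda>z. g z * h z) \<in> borel_measurable M"
    by measurable
  show "AE z in M. norm (g z * h z) \<le> norm (C * h z)"
    using assms(3) by eventually_elim (simp add: abs_mult mult_right_mono)
qed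

lemma integral_deriv_compact_support:
  fixes F f :: "real \<Rightarrow> real"
  assumes "\<And>x. (F has_real_derivative f x) (at x)" and "continuous_on UNIV f"
    and "\<And>x. R \<le> \<bar>x\<bar> \<Longrightarrow> F x = 0 \<and> f x = 0" and "a \<le> R"
  shows "(LINT x|lborel. indicator {a<..} x * f x) = - F a"
proof -
  have f0: "f x = 0" if "R \<le> \<bar>x\<bar>" for x using assms(3) that by blast
  \<comment> \<open>The upper limit \<open>\<bar>R\<bar>\<close> is at least \<open>a\<close>
    whatever the sign of \<open>R\<close>, and \<open>f\<close> vanishes beyond it.\<close>
  have "(LINT x|lborel. indicator {a<..} x * f x) = (LINT x|lborel. f x * indicator {a..\<bar>R\<bar>} x)"
  proof (rule integral_cong_AE)
    have [measurable]: "f \<in> borel_measurable borel"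
      using assms(2) borel_measurable_continuous_onI by blast
    show "(\<lambda>x. indicator {a<..} x * f x) \<in> borel_measurable lborel"
      "(\<lambda>x. f x * indicator {a..\<bar>R\<bar>} x) \<in> borel_measurable lborel"
      by measurable
    show "AE x in lborel. indicator {a<..} x * f x = f x * indicator {a..\<bar>R\<bar>} x"
      using AE_lborel_singleton[of a]
      by eventually_elim (use f0 in \<open>auto simp: indicator_def\<close>)
  qed
  also have "\<dots> = F \<bar>R\<bar> - F a"
    using assms by (intro integral_FTC_Icc_real) (auto simp: continuous_on_eq_continuous_at)
  also have "F \<bar>R\<bar> = 0"
    using assms(3) by auto
  finally show ?thesis by simp
qed

lemma half_plane_borel [measurable]: "({0<..} \<times> UNIV :: (real \<times> real) set) \<in> sets borel"
  unfolding borel_prod[symmetric] by (intro pair_measureI) auto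

text \<open>This is the weak formulation for constant states. By Fubini, the time derivative is
  integrated in \<open>t\<close> first, which leaves the value at \<open>t = 0\<close>, and the
  space derivative in \<open>x\<close> first, which leaves nothing.\<close>

lemma test_function_half_plane:
  assumes "test_function \<phi> \<phi>t \<phi>x"
  shows "(LINT (t, x):{0<..} \<times> UNIV|lborel. \<phi>t t x) = - (LINT x|lborel. \<phi> 0 x)"
    and "(LINT (t, x):{0<..} \<times> UNIV|lborel. \<phi>x t x) = 0"
proof -
  obtain R where R: "0 < R"
      "\<And>t x. R \<le> \<bar>t\<bar> \<or> R \<le> \<bar>x\<bar> \<Longrightarrow> \<phi> t x = 0 \<and> \<phi>t t x = 0 \<and> \<phi>x t x = 0"
    using test_function_support[OF assms] by blast
  have t: "((\<lambda>s. \<phi> s x) has_real_derivative \<phi>t t x) (at t)"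
    and x: "((\<lambda>y. \<phi> t y) has_real_derivative \<phi>x t x) (at x)"
    and ct: "continuous_on UNIV (\<lambda>(t, x). \<phi>t t x)"
    and cx: "continuous_on UNIV (\<lambda>(t, x). \<phi>x t x)" for t x
    using assms by (auto simp: test_function_def)
  have ct': "continuous_on UNIV (\<lambda>t. \<phi>t t x)" for x
    using continuous_on_compose2[OF ct, of UNIV "\<lambda>t. (t, x)"]
    by (simp add: continuous_on_Pair)
  have cx': "continuous_on UNIV (\<lambda>x. \<phi>x t x)" for t
    using continuous_on_compose2[OF cx, of UNIV "\<lambda>x. (t, x)"]
    by (simp add: continuous_on_Pair)
  have int: "integrable (lborel \<Otimes>\<^sub>M lborel) (\<lambda>(t, x). indicator {0<..} t * \<phi>t t x)"
    "integrable (lborel \<Otimes>\<^sub>M lborel) (\<lambda>(t, x). indicator {0<..} t * \<phi>x t x)"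
    using integrable_mult_indicator[OF _ test_function_integrable(1)[OF assms], of "{0<..} \<times> UNIV"]
      integrable_mult_indicator[OF _ test_function_integrable(2)[OF assms], of "{0<..} \<times> UNIV"]
    by (simp_all add: lborel_prod split_def indicator_times)
  have "(LINT (t, x):{0<..} \<times> UNIV|lborel. \<phi>t t x)
      = integral\<^sup>L (lborel \<Otimes>\<^sub>M lborel) (\<lambda>(t, x). indicator {0<..} t * \<phi>t t x)"
    by (simp add: set_lebesgue_integral_def lborel_prod split_def indicator_times)
  also have "\<dots> = (LINT x|lborel. LINT t|lborel. indicator {0<..} t * \<phi>t t x)"
    using lborel_pair.integral_snd[OF int(1)] by simp
  also have "\<dots> = (LINT x|lborel. - \<phi> 0 x)"
  proof (rule Bochner_Integration.integral_cong)
    show "(LINT t|lborel. indicator {0<..} t * \<phi>t t x) = - \<phi> 0 x" for x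
      using R t ct' by (intro integral_deriv_compact_support[where F = "\<lambda>t. \<phi> t x" and R = R]) auto
  qed simp
  finally show "(LINT (t, x):{0<..} \<times> UNIV|lborel. \<phi>t t x) = - (LINT x|lborel. \<phi> 0 x)"
    by simp
  have zero: "(LINT x|lborel. \<phi>x t x) = 0" for t
  proof -
    have "(LINT x|lborel. \<phi>x t x) = (LINT x|lborel. indicator {- R<..} x * \<phi>x t x)"
      using R by (intro Bochner_Integration.integral_cong) (auto simp: indicator_def)
    also have "\<dots> = - \<phi> t (- R)"
      using R x cx' by (intro integral_deriv_compact_support[where F = "\<phi> t" and R = R]) auto
    finally show ?thesis
      using R by auto
  qed
  have "(LINT (t, x):{0<..} \<times> UNIV|lborel. \<phi>x t x)
      = integral\<^sup>L (lborel \<Otimes>\<^sub>M lborel) (\<lambda>(t, x). indicator {0<..} t * \<phi>x t x)"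
    by (simp add: set_lebesgue_integral_def lborel_prod split_def indicator_times)
  also have "\<dots> = (LINT t|lborel. LINT x|lborel. indicator {0<..} t * \<phi>x t x)"
    using lborel_pair.integral_fst'[OF int(2)] by simp
  also have "\<dots> = (LINT t|lborel. indicator {0<..} t * (LINT x|lborel. \<phi>x t x))"
    by simp
  also have "\<dots> = 0"
    by (simp add: zero)
  finally show "(LINT (t, x):{0<..} \<times> UNIV|lborel. \<phi>x t x) = 0" .
qed

lemma set_integrable_of_integrable:
  fixes g :: "_ \<Rightarrow> real"
  assumes "integrable M g" and "S \<in> sets M"
  shows "set_integrable M S g"
  using integrable_mult_indicator[OF assms(2,1)] by (simp add: set_integrable_def)

section \<open>Entropy inequalities for the positive and negative parts\<close>

lemma borel_measurable_kruzkov_flux [measurable]: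
  assumes [measurable]: "f \<in> borel_measurable borel"
  shows "(\<lambda>v. kruzkov_flux f v k) \<in> borel_measurable borel"
  unfolding kruzkov_flux_def by measurable

lemma abs_kruzkov_flux_le: "\<bar>kruzkov_flux f v k\<bar> \<le> \<bar>f v - f k\<bar>"
  by (auto simp: kruzkov_flux_def sgn_if)

text \<open>For \<open>\<tau> = 1\<close> and \<open>\<tau> = -1\<close> the entropy is twice the positive and the negative part of \<open>u - k\<close>.\<close>

lemma semi_kruzkov_inequality:
  fixes f :: "real \<Rightarrow> real" and u :: "real \<Rightarrow> real \<Rightarrow> real"
  defines "w \<equiv> \<lambda>z. indicator ({0<..} \<times> UNIV) z * (case z of (t, x) \<Rightarrow> u t x)"
  assumes sol: "weak_entropy_solution f u0 u"
    and [measurable]: "f \<in> borel_measurable borel" and f_bound: "\<And>v. \<bar>f v\<bar> \<le> C"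
    and [measurable]: "u0 \<in> borel_measurable borel" and u0_bound: "\<And>x. \<bar>u0 x\<bar> \<le> K"
    and \<phi>: "test_function \<phi> \<phi>t \<phi>x" "\<And>t x. 0 \<le> \<phi> t x"
  shows "0 \<le> (LINT (t, x):{0<..} \<times> UNIV|lborel.
        (\<bar>w (t, x) - k\<bar> + \<tau> * (w (t, x) - k)) * \<phi>t t x
        + (kruzkov_flux f (w (t, x)) k + \<tau> * (f (w (t, x)) - f k)) * \<phi>x t x)
      + (LINT x|lborel. (\<bar>u0 x - k\<bar> + \<tau> * (u0 x - k)) * \<phi> 0 x)"
proof -
  let ?S = "{0<..} \<times> UNIV :: (real \<times> real) set"
  have w_eq: "w (t, x) = u t x" if "0 < t" for t x
    using that by (simp add: w_def)
  \<comment> \<open>Setting \<open>u\<close> to zero for \<open>t \<le> 0\<close> makes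
    \<open>w\<close> Borel measurable and essentially bounded on the whole plane.\<close>
  have [measurable]: "w \<in> borel_measurable borel"
    using sol by (simp add: weak_entropy_solution_def set_borel_measurable_def w_def)
  obtain B where B: "AE (t, x) in lborel. 0 < t \<longrightarrow> \<bar>u t x\<bar> \<le> B"
    using sol by (auto simp: weak_entropy_solution_def)
  have w_bound: "AE z in lborel. \<bar>w z\<bar> \<le> \<bar>B\<bar>"
    using B by eventually_elim (auto simp: w_def indicator_def)
  \<comment> \<open>A single growth condition covers all six integrands below: the identity and
    \<open>\<bar>v - k\<bar>\<close> grow linearly with slope 1, while \<open>f\<close> and the
    constants are bounded.\<close>
  have int_t: "set_integrable lborel ?S (\<lambda>(t, x). g (w (t, x)) * \<phi>t t x)"
    and int_x: "set_integrable lborel ?S (\<lambda>(t, x). g (w (t, x)) * \<phi>x t x)"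
    if [measurable]: "g \<in> borel_measurable borel" and "\<And>v. \<bar>g v\<bar> \<le> \<bar>v\<bar> + D" for g D
  proof -
    have bound: "AE z in lborel. \<bar>g (w z)\<bar> \<le> \<bar>B\<bar> + D"
      using w_bound by eventually_elim (use that(2) in \<open>smt (verit)\<close>)
    have gw: "(\<lambda>z. g (w z)) \<in> borel_measurable lborel"
      by measurable
    show "set_integrable lborel ?S (\<lambda>(t, x). g (w (t, x)) * \<phi>t t x)"
      using integrable_mult_AE_bounded[OF test_function_integrable(1)[OF \<phi>(1)] gw bound]
      by (intro set_integrable_of_integrable) (simp_all add: split_def)
    show "set_integrable lborel ?S (\<lambda>(t, x). g (w (t, x)) * \<phi>x t x)"
      using integrable_mult_AE_bounded[OF test_function_integrable(2)[OF \<phi>(1)] gw bound]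
      by (intro set_integrable_of_integrable) (simp_all add: split_def)
  qed
  have kr_bound: "\<bar>kruzkov_flux f v k\<bar> \<le> \<bar>v\<bar> + 2 * C" for v
    using abs_kruzkov_flux_le[of f v k] f_bound[of v] f_bound[of k] by linarith
  have f_bound': "\<bar>f v\<bar> \<le> \<bar>v\<bar> + C" for v
    using f_bound[of v] by linarith
  note int =
    int_t[of "\<lambda>v. \<bar>v - k\<bar>" "\<bar>k\<bar>"] int_x[of "\<lambda>v. kruzkov_flux f v k", OF _ kr_bound]
    int_t[of "\<lambda>v. v" 0] int_x[of f, OF _ f_bound'] int_t[of "\<lambda>_. k" "\<bar>k\<bar>"] int_x[of "\<lambda>_. f k" "\<bar>f k\<bar>"]
  define I1 I2 I3 I4 I5 I6 where
    "I1 = (LINT (t, x):?S|lborel. \<bar>w (t, x) - k\<bar> * \<phi>t t x)" and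
    "I2 = (LINT (t, x):?S|lborel. kruzkov_flux f (w (t, x)) k * \<phi>x t x)" and
    "I3 = (LINT (t, x):?S|lborel. w (t, x) * \<phi>t t x)" and
    "I4 = (LINT (t, x):?S|lborel. f (w (t, x)) * \<phi>x t x)" and
    "I5 = (LINT (t, x):?S|lborel. k * \<phi>t t x)" and
    "I6 = (LINT (t, x):?S|lborel. f k * \<phi>x t x)"
  have i1: "set_integrable lborel ?S (\<lambda>(t, x). \<bar>w (t, x) - k\<bar> * \<phi>t t x)"
    by (intro int) auto
  have i2: "set_integrable lborel ?S (\<lambda>(t, x). kruzkov_flux f (w (t, x)) k * \<phi>x t x)"
    by (intro int) auto
  have i3: "set_integrable lborel ?S (\<lambda>(t, x). w (t, x) * \<phi>t t x)"
    by (intro int) auto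
  have i4: "set_integrable lborel ?S (\<lambda>(t, x). f (w (t, x)) * \<phi>x t x)"
    by (intro int) auto
  have i5: "set_integrable lborel ?S (\<lambda>(t, x). k * \<phi>t t x)"
    by (intro int) auto
  have i6: "set_integrable lborel ?S (\<lambda>(t, x). f k * \<phi>x t x)"
    by (intro int) auto
  note i = i1 i2 i3 i4 i5 i6
  note i' = i[unfolded split_def]
  have split: "(LINT (t, x):?S|lborel.
        (\<bar>w (t, x) - k\<bar> + \<tau> * (w (t, x) - k)) * \<phi>t t x
        + (kruzkov_flux f (w (t, x)) k + \<tau> * (f (w (t, x)) - f k)) * \<phi>x t x)
      = I1 + I2 + \<tau> * (I3 + I4 - I5 - I6)"
  proof -
    have "(LINT (t, x):?S|lborel.
        (\<bar>w (t, x) - k\<bar> + \<tau> * (w (t, x) - k)) * \<phi>t t x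
        + (kruzkov_flux f (w (t, x)) k + \<tau> * (f (w (t, x)) - f k)) * \<phi>x t x)
      = (LINT z:?S|lborel. (\<bar>w z - k\<bar> * \<phi>t (fst z) (snd z) + kruzkov_flux f (w z) k * \<phi>x (fst z) (snd z))
          + \<tau> * (w z * \<phi>t (fst z) (snd z) + f (w z) * \<phi>x (fst z) (snd z)
            - k * \<phi>t (fst z) (snd z) - f k * \<phi>x (fst z) (snd z)))"
      by (intro set_lebesgue_integral_cong) (auto simp: algebra_simps)
    also have "\<dots> = I1 + I2 + \<tau> * (I3 + I4 - I5 - I6)"
      unfolding I1_def I2_def I3_def I4_def I5_def I6_def split_def
      using i' by (simp add: set_integral_add set_integral_diff)
    finally show ?thesis .
  qed
  have weak: "I3 + I4 + (LINT x|lborel. u0 x * \<phi> 0 x) = 0"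
  proof -
    have "I3 + I4 = (LINT (t, x):?S|lborel. u t x * \<phi>t t x + f (u t x) * \<phi>x t x)"
      unfolding I3_def I4_def set_integral_add(2)[OF i3 i4, symmetric]
      by (intro set_lebesgue_integral_cong) (auto simp: w_eq)
    then show ?thesis
      using sol \<phi> unfolding weak_entropy_solution_def weak_solution_def by simp
  qed
  have ent: "0 \<le> I1 + I2 + (LINT x|lborel. \<bar>u0 x - k\<bar> * \<phi> 0 x)"
  proof -
    have "I1 + I2 = (LINT (t, x):?S|lborel.
        \<bar>u t x - k\<bar> * \<phi>t t x + kruzkov_flux f (u t x) k * \<phi>x t x)"
      unfolding I1_def I2_def set_integral_add(2)[OF i1 i2, symmetric]
      by (intro set_lebesgue_integral_cong) (auto simp: w_eq)
    then show ?thesis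
      using sol \<phi> unfolding weak_entropy_solution_def entropy_condition_def by simp
  qed
  \<comment> \<open>The constant \<open>k\<close> is itself a weak solution with initial datum
    \<open>k\<close>.\<close>
  have const: "I5 = - k * (LINT x|lborel. \<phi> 0 x)" "I6 = 0"
    using test_function_half_plane[OF \<phi>(1)] by (simp_all add: I5_def I6_def split_def)
  have "integrable lborel (\<lambda>x. \<bar>u0 x - k\<bar> * \<phi> 0 x)" "integrable lborel (\<lambda>x. u0 x * \<phi> 0 x)"
  proof -
    have "AE x in lborel. \<bar>\<bar>u0 x - k\<bar>\<bar> \<le> K + \<bar>k\<bar>" "AE x in lborel. \<bar>u0 x\<bar> \<le> K"
      using u0_bound by (auto simp: abs_le_iff intro!: AE_I2) (smt (verit))+
    then show "integrable lborel (\<lambda>x. \<bar>u0 x - k\<bar> * \<phi> 0 x)" "integrable lborel (\<lambda>x. u0 x * \<phi> 0 x)"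
      by (intro integrable_mult_AE_bounded[OF test_function_integrable(3)[OF \<phi>(1)]]; simp)+
  qed
  moreover have "(\<lambda>x. (\<bar>u0 x - k\<bar> + \<tau> * (u0 x - k)) * \<phi> 0 x)
      = (\<lambda>x. \<bar>u0 x - k\<bar> * \<phi> 0 x + \<tau> * (u0 x * \<phi> 0 x - k * \<phi> 0 x))"
    by (simp add: fun_eq_iff algebra_simps)
  ultimately have init: "(LINT x|lborel. (\<bar>u0 x - k\<bar> + \<tau> * (u0 x - k)) * \<phi> 0 x)
      = (LINT x|lborel. \<bar>u0 x - k\<bar> * \<phi> 0 x)
        + \<tau> * ((LINT x|lborel. u0 x * \<phi> 0 x) - k * (LINT x|lborel. \<phi> 0 x))"
    using test_function_integrable(3)[OF \<phi>(1)] by simp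
  \<comment> \<open>The entropy inequality is combined with \<open>\<tau>\<close> times the
    difference of the weak formulations of \<open>u\<close> and of \<open>k\<close>. Those are
    identities, so \<open>\<tau>\<close> may have either sign.\<close>
  have "I1 + I2 + \<tau> * (I3 + I4 - I5 - I6) + ((LINT x|lborel. \<bar>u0 x - k\<bar> * \<phi> 0 x)
        + \<tau> * ((LINT x|lborel. u0 x * \<phi> 0 x) - k * (LINT x|lborel. \<phi> 0 x)))
      = (I1 + I2 + (LINT x|lborel. \<bar>u0 x - k\<bar> * \<phi> 0 x))
        + \<tau> * (I3 + I4 + (LINT x|lborel. u0 x * \<phi> 0 x))"
    by (simp add: const algebra_simps)
  then show ?thesis
    using ent weak by (simp add: split init)
qed

subsection \<open>A cutoff near the junction\<close>

text \<open>Squaring makes the positive part continuously differentiable, so that cutoffs composed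
  from it qualify as test functions.\<close>

definition pos_sq :: "real \<Rightarrow> real" where
  "pos_sq x = (max 0 x)\<^sup>2"

text \<open>The difference quotient differs from \<open>2 * max 0 x\<close> by at most
  \<open>\<bar>y - x\<bar>\<close>, which is checked for each combination of signs of
  \<open>x\<close> and \<open>y\<close>.\<close>

lemma has_real_derivative_pos_sq: "(pos_sq has_real_derivative 2 * max 0 x) (at x)"
proof -
  have bound: "\<bar>(pos_sq y - pos_sq x) / (y - x) - 2 * max 0 x\<bar> \<le> \<bar>y - x\<bar>" if "y \<noteq> x" for y
  proof -
    have "\<bar>pos_sq y - pos_sq x - 2 * max 0 x * (y - x)\<bar> \<le> \<bar>y - x\<bar> * \<bar>y - x\<bar>"
    proof -
      consider "0 \<le> x" "0 \<le> y" | "x \<le> 0" "y \<le> 0" | "x \<le> 0" "0 \<le> y" | "0 \<le> x" "y \<le> 0"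
        by linarith
      then show ?thesis
      proof cases
        case 1
        then have "pos_sq y - pos_sq x - 2 * max 0 x * (y - x) = (y - x) * (y - x)"
          by (simp add: pos_sq_def algebra_simps power2_eq_square)
        then show ?thesis by (simp only: abs_mult)
      next
        case 2
        then show ?thesis by (simp add: pos_sq_def)
      next
        case 3
        then have "y * y \<le> (y - x) * (y - x)" by (intro mult_mono) auto
        with 3 show ?thesis by (simp add: pos_sq_def power2_eq_square abs_mult_self)
      next
        case 4
        then have "0 \<le> y * y" "x * y \<le> 0" by (auto simp: mult_nonneg_nonpos)
        then have "\<bar>- (x * x) - 2 * x * (y - x)\<bar> \<le> (y - x) * (y - x)"
        proof -
          have "- (x * x) - 2 * x * (y - x) = x * x - 2 * (x * y)"
            "(y - x) * (y - x) = y * y - 2 * (x * y) + x * x"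
            by (simp_all add: algebra_simps)
          with \<open>0 \<le> y * y\<close> \<open>x * y \<le> 0\<close> zero_le_square[of x] show ?thesis
            by linarith
        qed
        with 4 show ?thesis
          by (simp add: pos_sq_def power2_eq_square abs_mult_self) (simp add: algebra_simps)
      qed
    qed
    then show ?thesis
      using that by (simp add: abs_le_iff field_simps abs_if split: if_splits)
  qed
  have "((\<lambda>y. \<bar>y - x\<bar>) \<longlongrightarrow> 0) (at x)"
    by (rule tendsto_eq_intros refl | simp)+
  then have "((\<lambda>y. (pos_sq y - pos_sq x) / (y - x) - 2 * max 0 x) \<longlongrightarrow> 0) (at x)"
    by (rule Lim_null_comparison[rotated]) (auto simp: eventually_at_filter bound)
  then show ?thesis
    by (simp add: has_field_derivative_iff LIM_zero_iff)
qed

lemma continuous_on_pos_sq [continuous_intros]: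
  "continuous_on S g \<Longrightarrow> continuous_on S (\<lambda>x. pos_sq (g x))"
  unfolding pos_sq_def by (intro continuous_intros)

lemma pos_sq_nonneg [simp]: "0 \<le> pos_sq x"
  by (simp add: pos_sq_def)

lemma pos_sq_eq_0 [simp]: "x \<le> 0 \<Longrightarrow> pos_sq x = 0"
  by (simp add: pos_sq_def)

lemma pos_sq_le: "x \<le> y \<Longrightarrow> pos_sq x \<le> pos_sq y"
  unfolding pos_sq_def by (intro power_mono) auto

lemma pos_sq_one [simp]: "pos_sq 1 = 1"
  by (simp add: pos_sq_def)

text \<open>A continuously differentiable step: 0 for \<open>y \<le> - 1\<close>, 1 for
  \<open>y \<ge> 0\<close>, and \<open>1 - (1 - (1 + y)\<^sup>2)\<^sup>2\<close> in between, whose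
  derivative vanishes at both ends.\<close>

definition ramp :: "real \<Rightarrow> real" where
  "ramp y = 1 - pos_sq (1 - pos_sq (1 + y))"

definition ramp_deriv :: "real \<Rightarrow> real" where
  "ramp_deriv y = 4 * max 0 (1 - pos_sq (1 + y)) * max 0 (1 + y)"

lemma DERIV_pos_sq [derivative_intros]:
  "(g has_real_derivative D) (at x within S) \<Longrightarrow>
   ((\<lambda>x. pos_sq (g x)) has_real_derivative 2 * max 0 (g x) * D) (at x within S)"
  by (rule DERIV_chain2[OF has_real_derivative_pos_sq])

lemma DERIV_ramp [derivative_intros]:
  "(g has_real_derivative D) (at x within S) \<Longrightarrow>
   ((\<lambda>x. ramp (g x)) has_real_derivative ramp_deriv (g x) * D) (at x within S)"
  unfolding ramp_def ramp_deriv_def by (rule derivative_eq_intros refl | assumption | simp)+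

lemma continuous_on_ramp [continuous_intros]:
  "continuous_on S g \<Longrightarrow> continuous_on S (\<lambda>x. ramp (g x))"
  unfolding ramp_def by (intro continuous_intros)

lemma continuous_on_ramp_deriv [continuous_intros]:
  "continuous_on S g \<Longrightarrow> continuous_on S (\<lambda>x. ramp_deriv (g x))"
  unfolding ramp_deriv_def by (intro continuous_intros)

lemma ramp_bounds: "0 \<le> ramp y" "ramp y \<le> 1"
  using pos_sq_le[of "1 - pos_sq (1 + y)" 1] by (simp_all add: ramp_def)

lemma ramp_eq_0: "y \<le> - 1 \<Longrightarrow> ramp y = 0"
  by (simp add: ramp_def)

lemma ramp_deriv_nonneg: "0 \<le> ramp_deriv y"
  by (simp add: ramp_deriv_def)

lemma ramp_deriv_eq_0: "y \<le> - 1 \<or> 0 \<le> y \<Longrightarrow> ramp_deriv y = 0"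
  using pos_sq_le[of 1 "1 + y"] by (auto simp: ramp_deriv_def max_def)

lemma ramp_deriv_le: "ramp_deriv y \<le> 4"
proof (cases "0 \<le> y")
  case True
  then show ?thesis by (simp add: ramp_deriv_eq_0)
next
  case False
  then have "max 0 (1 - pos_sq (1 + y)) * max 0 (1 + y) \<le> 1 * 1"
    by (intro mult_mono) auto
  then show ?thesis by (simp add: ramp_deriv_def)
qed

lemma ramp_deriv_pos: "- 1 < y \<Longrightarrow> y < 0 \<Longrightarrow> 0 < ramp_deriv y"
  using power_strict_mono[of "1 + y" 1 2] by (auto simp: ramp_deriv_def pos_sq_def)

text \<open>
  As \<open>\<sigma> c > 0\<close>, the first factor lives on \<open>\<sigma> x > - \<sigma> c\<close>. The second one decreases along cones of
  speed \<open>L\<close>, which absorbs the entropy flux away from the junction.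
\<close>

lemma test_function_barrier:
  assumes sg: "\<sigma> = 1 \<or> \<sigma> = - 1" and c: "0 < \<sigma> * c" and "0 \<le> L"
  shows "test_function
    (\<lambda>t x. ramp (x / c) * pos_sq (1 - (\<sigma> * x + L * t)) * pos_sq (1 - t * t))
    (\<lambda>t x. ramp (x / c) * (- 2 * L * max 0 (1 - (\<sigma> * x + L * t)) * pos_sq (1 - t * t)
       - pos_sq (1 - (\<sigma> * x + L * t)) * (4 * t * max 0 (1 - t * t))))
    (\<lambda>t x. (ramp_deriv (x / c) / c * pos_sq (1 - (\<sigma> * x + L * t))
       - ramp (x / c) * (2 * \<sigma> * max 0 (1 - (\<sigma> * x + L * t)))) * pos_sq (1 - t * t))"
proof -
  let ?\<phi> = "\<lambda>t x. ramp (x / c) * pos_sq (1 - (\<sigma> * x + L * t)) * pos_sq (1 - t * t)"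
  have c0: "c \<noteq> 0" using c by auto
  \<comment> \<open>On the support \<bar>t\<bar> < 1 and - \<sigma> c < \<sigma> x < 1 - L t, which
    is at most 1 + L. The last factor of \<open>?\<phi>\<close> bounds negative times too, as
    compact support is required on the whole plane.\<close>
  let ?R = "1 + L + \<bar>c\<bar>"
  have "(t, x) \<in> cbox (-1, - ?R) (1, ?R)" if "?\<phi> t x \<noteq> 0" for t x
  proof -
    have ne: "ramp (x / c) \<noteq> 0" "pos_sq (1 - (\<sigma> * x + L * t)) \<noteq> 0" "pos_sq (1 - t * t) \<noteq> 0"
      using that by auto
    have "t\<^sup>2 < 1\<^sup>2"
      using ne(3) pos_sq_eq_0[of "1 - t * t"] by (auto simp: not_le[symmetric] power2_eq_square)
    then have t: "\<bar>t\<bar> < 1"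
      by (simp add: abs_square_less_1)
    have "- 1 < x / c"
      using ne(1) ramp_eq_0[of "x / c"] by force
    then have 1: "- (\<sigma> * c) < \<sigma> * x"
      using sg c by (auto simp: field_simps)
    have 2: "\<sigma> * x + L * t < 1"
      using ne(2) by (meson diff_le_0_iff_le not_le pos_sq_eq_0)
    have "\<bar>L * t\<bar> \<le> L"
      using t \<open>0 \<le> L\<close> by (simp add: abs_mult mult_left_le)
    with 1 2 have "\<bar>x\<bar> \<le> ?R"
      using sg \<open>0 \<le> L\<close> by auto
    with t show "(t, x) \<in> cbox (-1, - ?R) (1, ?R)"
      by (auto simp: cbox_Pair_eq)
  qed
  then have "{(t, x). ?\<phi> t x \<noteq> 0} \<subseteq> cbox (-1, - ?R) (1, ?R)"
    by blast
  then have "bounded {(t, x). ?\<phi> t x \<noteq> 0}"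
    using bounded_cbox bounded_subset by blast
  then have "compact (closure {(t, x). ?\<phi> t x \<noteq> 0})"
    by (simp add: compact_closure)
  then show ?thesis
    unfolding test_function_def split_def using c0
    by (auto intro!: derivative_eq_intros continuous_intros simp: algebra_simps)
qed

section \<open>Blow-up of the entropy inequality at the junction\<close>

lemma lborel_integral_scale_snd:
  fixes g :: "real \<times> real \<Rightarrow> real"
  assumes "integrable lborel g" and "integrable lborel (\<lambda>(t, y). g (t, c * y))" and "c \<noteq> 0"
  shows "integral\<^sup>L lborel g = \<bar>c\<bar> * (LINT (t, y)|lborel. g (t, c * y))"
proof -
  have "integral\<^sup>L lborel g = (LINT t|lborel. LINT x|lborel. g (t, x))"
    using lborel_pair.integral_fst'[of g] assms(1) by (simp add: lborel_prod)
  also have "\<dots> = (LINT t|lborel. \<bar>c\<bar> * (LINT y|lborel. g (t, c * y)))"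
  proof (intro Bochner_Integration.integral_cong refl)
    show "(LINT x|lborel. g (t, x)) = \<bar>c\<bar> * (LINT y|lborel. g (t, c * y))" for t
      using lborel_integral_real_affine[OF assms(3), of "\<lambda>x. g (t, x)" 0] by simp
  qed
  also have "\<dots> = \<bar>c\<bar> * (LINT (t, y)|lborel. g (t, c * y))"
    using lborel_pair.integral_fst'[of "\<lambda>(t, y). g (t, c * y)"] assms(2) by (simp add: lborel_prod)
  finally show ?thesis .
qed

lemma integrable_bounded_box:
  fixes g :: "real \<times> real \<Rightarrow> real"
  assumes "g \<in> borel_measurable borel" and "\<And>z. \<bar>g z\<bar> \<le> K * indicator (cbox a b) z"
  shows "integrable lborel g"
proof (rule Bochner_Integration.integrable_bound)
  show "integrable lborel (\<lambda>z. K * indicator (cbox a b) z)"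
    by (intro integrable_mult_right integrable_real_indicator)
      (auto simp: emeasure_lborel_cbox_eq)
  show "AE z in lborel. norm (g z) \<le> norm (K * indicator (cbox a b) z)"
    using assms(2) by (auto intro!: AE_I2 intro: order_trans[OF _ abs_ge_self])
qed (use assms(1) in simp)

text \<open>
  \<open>(E, F)\<close> is an entropy pair and \<open>init\<close> the entropy of the initial datum, which is supported in the
  road \<open>{x. \<sigma> x < 0}\<close>.
\<close>

lemma trace_flux_sign:
  fixes w :: "real \<times> real \<Rightarrow> real" and E F :: "real \<Rightarrow> real"
  assumes w: "w \<in> borel_measurable borel" "AE z in lborel. \<bar>E (w z)\<bar> \<le> B"
    and E [measurable]: "E \<in> borel_measurable borel" and "\<And>v. 0 \<le> E v"
    and F [measurable]: "F \<in> borel_measurable borel"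
    and F_le: "\<And>v. \<bar>F v\<bar> \<le> L * E v" and F_bound: "\<And>v. \<bar>F v\<bar> \<le> C"
    and "0 < L" and sg: "\<sigma> = 1 \<or> \<sigma> = - 1"
    and init: "\<And>x. 0 \<le> init x" "\<And>x. init x \<le> e" "\<And>x. 0 \<le> \<sigma> * x \<Longrightarrow> init x = 0"
    and ineq: "\<And>\<phi> \<phi>t \<phi>x. test_function \<phi> \<phi>t \<phi>x \<Longrightarrow> (\<And>t x. 0 \<le> \<phi> t x) \<Longrightarrow>
      0 \<le> (LINT (t, x):{0<..} \<times> UNIV|lborel. E (w (t, x)) * \<phi>t t x + F (w (t, x)) * \<phi>x t x)
        + (LINT x|lborel. init x * \<phi> 0 x)"
    and trace: "\<And>t. 0 < t \<Longrightarrow> ((\<lambda>x. F (w (t, x))) \<longlongrightarrow> l) (at 0 within {x. \<sigma> * x < 0})"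
  shows "0 \<le> \<sigma> * l"
proof -
  note w(1) [measurable]
  have C: "0 \<le> C" using F_bound[of 0] by linarith
  have e: "0 \<le> e" using init(1)[of 0] init(2)[of 0] by linarith
  \<comment> \<open>The term of the entropy inequality which concentrates at the junction as \<open>c \<rightarrow> 0\<close>, in the
    stretched variable \<open>y = x / c\<close>.\<close>
  define H where "H = (\<lambda>c (t, y). indicator {0<..} t *
    (F (w (t, c * y)) * (ramp_deriv y * pos_sq (1 - (\<sigma> * c * y + L * t)) * pos_sq (1 - t * t))))"
  have [measurable]: "(\<lambda>z. w (fst z, c * snd z)) \<in> borel_measurable borel" for c
    by (rule measurable_compose[OF _ w(1)], rule borel_measurable_continuous_onI)
      (intro continuous_intros)
  have [measurable]: "ramp_deriv \<in> borel_measurable borel" "pos_sq \<in> borel_measurable borel"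
    by (auto intro!: borel_measurable_continuous_onI continuous_intros)
  have [measurable]: "(fst :: real \<times> real \<Rightarrow> real) \<in> borel_measurable borel"
    "(snd :: real \<times> real \<Rightarrow> real) \<in> borel_measurable borel"
    by (auto intro!: borel_measurable_continuous_onI continuous_intros)
  have ramp_deriv_support: "ramp_deriv y = 0" if "y \<notin> {-1..0}" for y
    using that by (intro ramp_deriv_eq_0) auto
  have C_support: "pos_sq (1 - t * t) = 0" if "0 < t" "t \<notin> {0..1}" for t :: real
    using that by (intro pos_sq_eq_0) (auto simp: mult_ge1_I)
  have H_meas: "H c \<in> borel_measurable borel" for c
    unfolding H_def split_def by measurable
  \<comment> \<open>The constant is C * 4 * 4 * 1: \<open>F\<close> is bounded by \<open>C\<close>,
    \<open>ramp_deriv\<close> by 4, the cone factor by \<open>pos_sq 2\<close> as \<sigma> c \<le>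
    1, and the time factor by 1. It does not depend on \<open>c\<close>, so it serves for dominated
    convergence.\<close>
  have H_bound: "\<bar>H c z\<bar> \<le> 16 * C * indicator (cbox (0, -1) (1, 0)) z"
    if c: "0 < \<sigma> * c" "\<sigma> * c \<le> 1" for c z
  proof (cases z)
    case (Pair t y)
    show ?thesis
    proof (cases "0 < t \<and> t \<le> 1 \<and> -1 \<le> y \<and> y \<le> 0")
      case True
      have "(\<sigma> * c) * - y \<le> 1 * 1"
        using c True by (intro mult_mono) auto
      moreover have "0 \<le> L * t"
        using True \<open>0 < L\<close> by simp
      ultimately have "pos_sq (1 - (\<sigma> * c * y + L * t)) \<le> pos_sq 2"
        by (intro pos_sq_le) (simp add: algebra_simps)
      also have "pos_sq 2 = 4"
        by (simp add: pos_sq_def)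
      finally have 1: "pos_sq (1 - (\<sigma> * c * y + L * t)) \<le> 4" .
      have 2: "pos_sq (1 - t * t) \<le> 1"
        using pos_sq_le[of "1 - t * t" 1] by simp
      have "\<bar>F (w (t, c * y))\<bar> * (ramp_deriv y * pos_sq (1 - (\<sigma> * c * y + L * t)) * pos_sq (1 - t * t))
          \<le> C * (4 * 4 * 1)"
        using C 1 2 ramp_deriv_le ramp_deriv_nonneg F_bound
        by (intro mult_mono mult_nonneg_nonneg) auto
      then show ?thesis
        using True Pair ramp_deriv_nonneg[of y] by (simp add: H_def abs_mult cbox_Pair_eq)
    next
      case False
      then have "H c z = 0"
        using Pair ramp_deriv_support[of y] C_support[of t] by (auto simp: H_def indicator_def)
      then show ?thesis
        using C by simp
    qed
  qed
  have H_int: "integrable lborel (H c)" if "0 < \<sigma> * c" "\<sigma> * c \<le> 1" for c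
    using H_bound[OF that] by (intro integrable_bounded_box H_meas)
  \<comment> \<open>The entropy inequality tested with the barrier of width \<sigma> c. The error
    term stems from the initial datum and disappears in the limit.\<close>
  have key: "0 \<le> \<sigma> * integral\<^sup>L lborel (H c) + 8 * e * (\<sigma> * c)"
    if c: "0 < \<sigma> * c" "\<sigma> * c \<le> 1" for c
  proof -
    have c0: "c \<noteq> 0" using c by auto
    have abs_c: "\<bar>c\<bar> = \<sigma> * c" "\<bar>c\<bar> = c / \<sigma>" using sg c by auto
    let ?S = "{0<..} \<times> UNIV :: (real \<times> real) set"
    let ?B = "\<lambda>t x. pos_sq (1 - (\<sigma> * x + L * t))" and ?C = "\<lambda>t :: real. pos_sq (1 - t * t)"
    let ?B' = "\<lambda>t x. max 0 (1 - (\<sigma> * x + L * t))"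
    define \<phi> \<phi>t \<phi>x where
      "\<phi> t x = ramp (x / c) * ?B t x * ?C t" and
      "\<phi>t t x = ramp (x / c) * (- 2 * L * ?B' t x * ?C t - ?B t x * (4 * t * max 0 (1 - t * t)))" and
      "\<phi>x t x = (ramp_deriv (x / c) / c * ?B t x - ramp (x / c) * (2 * \<sigma> * ?B' t x)) * ?C t"
      for t x
    \<comment> \<open>The part of the flux term in which the derivative falls on the ramp, in the
      original variable \<open>x\<close>.\<close>
    define G where "G z = (case z of (t, x) \<Rightarrow> H c (t, x / c) / c)" for z
    have test: "test_function \<phi> \<phi>t \<phi>x"
      using test_function_barrier[OF sg c(1), of L] \<open>0 < L\<close>
      unfolding \<phi>_def[abs_def] \<phi>t_def[abs_def] \<phi>x_def[abs_def] by simp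
    have nonneg: "0 \<le> \<phi> t x" for t x
      using ramp_bounds by (simp add: \<phi>_def)
    have G_meas: "G \<in> borel_measurable borel"
    proof -
      have "(\<lambda>z. H c (fst z, snd z / c)) \<in> borel_measurable borel"
        by (rule measurable_compose[OF _ H_meas], rule borel_measurable_continuous_onI)
          (use c0 in \<open>intro continuous_intros; simp\<close>)
      then show ?thesis
        by (simp add: G_def[abs_def] split_def)
    qed
    have G_bound: "\<bar>G z\<bar> \<le> 16 * C / \<bar>c\<bar> * indicator (cbox (0, -1) (1, 1)) z" for z
    proof (cases z)
      case (Pair t x)
      have "\<bar>H c (t, x / c)\<bar> \<le> 16 * C * indicator (cbox (0, -1) (1, 0)) (t, x / c)"
        by (rule H_bound[OF c])
      also have "\<dots> \<le> 16 * C * indicator (cbox (0, -1) (1, 1)) z"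
      proof (intro mult_left_mono)
        have "x \<in> {-1..1}" if "x / c \<in> {-1..0}"
          using that sg c by (auto simp: field_simps)
        then show "indicator (cbox (0, -1) (1, 0)) (t, x / c) \<le> (indicator (cbox (0, -1) (1, 1)) z :: real)"
          using Pair by (auto simp: indicator_def cbox_Pair_eq)
      qed (use C in auto)
      finally show ?thesis
        using Pair c0 by (simp add: G_def divide_right_mono)
    qed
    have G_int: "integrable lborel G"
      using G_bound by (intro integrable_bounded_box G_meas)
    have H_eq: "(\<lambda>(t, y). G (t, c * y)) = (\<lambda>z. H c z / c)"
      using c0 by (auto simp: G_def)
    \<comment> \<open>The factor \<bar>c\<bar> from the change of variables meets the 1 / c from
      differentiating \<open>ramp (x / c)\<close>. Their product is \<sigma>, which is how the
      orientation of the road enters.\<close>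
    have "integral\<^sup>L lborel G = \<bar>c\<bar> * integral\<^sup>L lborel (\<lambda>z. H c z / c)"
      using lborel_integral_scale_snd[OF G_int _ c0] H_int[OF c] by (simp add: H_eq)
    also have "\<dots> = \<sigma> * integral\<^sup>L lborel (H c)"
      using c0 abs_c(1) by simp
    finally have G_eq: "integral\<^sup>L lborel G = \<sigma> * integral\<^sup>L lborel (H c)" .
    have int_E: "integrable lborel (\<lambda>(t, x). E (w (t, x)) * \<phi>t t x + F (w (t, x)) * \<phi>x t x)"
    proof -
      have "integrable lborel (\<lambda>z. E (w z) * (case z of (t, x) \<Rightarrow> \<phi>t t x))"
        using w by (intro integrable_mult_AE_bounded[OF test_function_integrable(1)[OF test]]) measurable
      moreover have "integrable lborel (\<lambda>z. F (w z) * (case z of (t, x) \<Rightarrow> \<phi>x t x))"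
        using F_bound by (intro integrable_mult_AE_bounded[OF test_function_integrable(2)[OF test], where C = C]) auto
      ultimately show ?thesis
        unfolding split_def by (subst Bochner_Integration.integrable_add) auto
    qed
    \<comment> \<open>All terms other than \<open>G\<close> have a sign: differentiating the cone
      factor gives a nonpositive multiple of \<open>L * E + \<sigma> * F\<close>, which is
      nonnegative by the bound on \<open>F\<close>, and the time factor decreases for positive
      \<open>t\<close>.\<close>
    have pointwise: "E (w (t, x)) * \<phi>t t x + F (w (t, x)) * \<phi>x t x \<le> G (t, x)" if "0 < t" for t x
    proof -
      let ?E = "E (w (t, x))" and ?F = "F (w (t, x))"
      have eq: "?E * \<phi>t t x + ?F * \<phi>x t x - G (t, x)
          = - ((2 * ramp (x / c) * ?B' t x * ?C t) * (L * ?E + \<sigma> * ?F))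
            - ?E * ramp (x / c) * ?B t x * (4 * t * max 0 (1 - t * t))"
        using that c0 by (simp add: \<phi>t_def \<phi>x_def G_def H_def algebra_simps)
      have p: "0 \<le> (2 * ramp (x / c) * ?B' t x * ?C t) * (L * ?E + \<sigma> * ?F)"
        using F_le[of "w (t, x)"] sg ramp_bounds by (intro mult_nonneg_nonneg) auto
      have q: "0 \<le> ?E * ramp (x / c) * ?B t x * (4 * t * max 0 (1 - t * t))"
        using assms(4) ramp_bounds that by (intro mult_nonneg_nonneg) auto
      from eq p q show ?thesis
        by linarith
    qed
    have "(LINT (t, x):?S|lborel. E (w (t, x)) * \<phi>t t x + F (w (t, x)) * \<phi>x t x)
        \<le> (LINT z:?S|lborel. G z)"
      using int_E G_int pointwise
      by (intro set_integral_mono set_integrable_of_integrable) auto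
    also have "\<dots> = integral\<^sup>L lborel G"
      unfolding set_lebesgue_integral_def
      by (intro Bochner_Integration.integral_cong) (auto simp: G_def H_def indicator_def)
    finally have 1: "(LINT (t, x):?S|lborel. E (w (t, x)) * \<phi>t t x + F (w (t, x)) * \<phi>x t x)
        \<le> \<sigma> * integral\<^sup>L lborel (H c)"
      by (simp add: G_eq)
    \<comment> \<open>\<open>init\<close> vanishes for \<sigma> x \<ge> 0 and the ramp for \<sigma>
      x \<le> - \<sigma> c. In between the product is at most \<open>e * 4\<close>, and the
      enclosing interval has length 2 \<bar>c\<bar>.\<close>
    have "(LINT x|lborel. init x * \<phi> 0 x) \<le> (LINT x|lborel. (e * 4) * indicator {- \<bar>c\<bar>..\<bar>c\<bar>} x)"
    proof (rule integral_mono')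
      fix x
      show "init x * \<phi> 0 x \<le> (e * 4) * indicator {- \<bar>c\<bar>..\<bar>c\<bar>} x"
      proof (cases "\<sigma> * x < 0 \<and> - (\<sigma> * c) \<le> \<sigma> * x")
        case True
        then have "\<bar>x\<bar> \<le> \<bar>c\<bar>" "pos_sq (1 - \<sigma> * x) \<le> pos_sq 2"
          using sg c by (auto intro!: pos_sq_le)
        moreover have "pos_sq 2 = 4"
          by (simp add: pos_sq_def)
        ultimately have "init x * (ramp (x / c) * pos_sq (1 - \<sigma> * x)) \<le> e * (1 * 4)"
          using init e ramp_bounds by (intro mult_mono mult_nonneg_nonneg) auto
        then show ?thesis
          using \<open>\<bar>x\<bar> \<le> \<bar>c\<bar>\<close> by (simp add: \<phi>_def abs_le_iff)
      next
        case False
        have "init x * \<phi> 0 x = 0"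
        proof (cases "0 \<le> \<sigma> * x")
          case True
          then show ?thesis using init(3) by simp
        next
          case False
          with \<open>\<not> (\<sigma> * x < 0 \<and> - (\<sigma> * c) \<le> \<sigma> * x)\<close> have "x / c \<le> - 1"
            using sg c by (auto simp: field_simps)
          then show ?thesis by (simp add: \<phi>_def ramp_eq_0)
        qed
        moreover have "0 \<le> (e * 4) * indicator {- \<bar>c\<bar>..\<bar>c\<bar>} x"
          using e by simp
        ultimately show ?thesis by linarith
      qed
    qed (use e in auto)
    also have "\<dots> = 8 * e * (\<sigma> * c)"
      using abs_c(1) by simp
    finally show ?thesis
      using ineq[OF test nonneg] 1 by linarith
  qed
  define I where "I = (\<lambda>(t, y). indicator {0<..} t *
    (ramp_deriv y * pos_sq (1 - L * t) * pos_sq (1 - t * t)) :: real)"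
  \<comment> \<open>The sign of \<open>c k\<close> is chosen so that \<sigma> c = 1 / (k + 1), which
    lies in (0, 1] on both kinds of road.\<close>
  define c where "c k = \<sigma> / real (Suc k)" for k
  have c: "0 < \<sigma> * c k" "\<sigma> * c k \<le> 1" for k
    using sg by (auto simp: c_def)
  have c_lim: "c \<longlonglongrightarrow> 0"
    unfolding c_def by (rule lim_const_over_n[THEN LIMSEQ_Suc])
  have \<sigma>c_lim: "(\<lambda>k. \<sigma> * c k) \<longlonglongrightarrow> 0"
    using tendsto_mult_left[OF c_lim, of \<sigma>] by simp
  \<comment> \<open>For \<open>y < 0\<close> the points \<open>c k * y\<close> approach the junction
    from inside the road, where the trace applies. For \<open>y \<ge> 0\<close> or
    \<open>t \<le> 0\<close> both sides vanish.\<close>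
  have H_lim: "(\<lambda>k. H (c k) z) \<longlonglongrightarrow> l * I z" for z
  proof (cases z)
    case (Pair t y)
    show ?thesis
    proof (cases "0 < t \<and> y < 0")
      case True
      have "(\<lambda>k. c k * y) \<longlonglongrightarrow> 0"
        using tendsto_mult_right[OF c_lim, of y] by simp
      moreover have neg: "\<sigma> * (c k * y) < 0" for k
        using c(1)[of k] True by (simp add: mult.assoc[symmetric] mult_pos_neg)
      moreover have "c k * y \<noteq> 0" for k
        using neg[of k] by (metis less_irrefl mult_zero_right)
      ultimately have lim: "filterlim (\<lambda>k. c k * y) (at 0 within {x. \<sigma> * x < 0}) sequentially"
        unfolding filterlim_at by (intro conjI always_eventually allI) simp_all
      have "(\<lambda>k. F (w (t, c k * y))) \<longlonglongrightarrow> l"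
        using filterlim_compose[OF trace lim] True by simp
      moreover have "(\<lambda>k. pos_sq (1 - (\<sigma> * c k * y + L * t))) \<longlonglongrightarrow> pos_sq (1 - (0 * y + L * t))"
        unfolding pos_sq_def by (intro tendsto_intros \<sigma>c_lim)
      ultimately have "(\<lambda>k. F (w (t, c k * y)) * (ramp_deriv y * pos_sq (1 - (\<sigma> * c k * y + L * t)) * pos_sq (1 - t * t)))
          \<longlonglongrightarrow> l * (ramp_deriv y * pos_sq (1 - (0 * y + L * t)) * pos_sq (1 - t * t))"
        by (intro tendsto_intros)
      then show ?thesis
        using Pair True by (simp add: H_def I_def)
    next
      case False
      then show ?thesis
        using Pair by (auto simp: H_def I_def ramp_deriv_eq_0 indicator_def)
    qed
  qed
  have I_meas: "I \<in> borel_measurable borel"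
    unfolding I_def split_def by measurable
  have I_nonneg: "0 \<le> I z" for z
    by (cases z) (simp add: I_def ramp_deriv_nonneg)
  have I_bound: "\<bar>I z\<bar> \<le> 16 * indicator (cbox (0, -1) (1, 0)) z" for z
  proof (cases z)
    case (Pair t y)
    show ?thesis
    proof (cases "0 < t \<and> t \<le> 1 \<and> -1 \<le> y \<and> y \<le> 0")
      case True
      then have "pos_sq (1 - L * t) \<le> 1" "pos_sq (1 - t * t) \<le> 1"
        using pos_sq_le[of "1 - t * t" 1] pos_sq_le[of "1 - L * t" 1] \<open>0 < L\<close> by simp_all
      then have "ramp_deriv y * pos_sq (1 - L * t) * pos_sq (1 - t * t) \<le> 4 * 1 * 1"
        using ramp_deriv_le ramp_deriv_nonneg by (intro mult_mono mult_nonneg_nonneg) auto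
      then show ?thesis
        using True Pair ramp_deriv_nonneg[of y] by (simp add: I_def abs_mult cbox_Pair_eq)
    next
      case False
      then have "I z = 0"
        using Pair ramp_deriv_support[of y] C_support[of t] by (auto simp: I_def indicator_def)
      then show ?thesis by simp
    qed
  qed
  have I_int: "integrable lborel I"
    using I_bound by (intro integrable_bounded_box I_meas)
  have "(\<lambda>k. integral\<^sup>L lborel (H (c k))) \<longlonglongrightarrow> integral\<^sup>L lborel (\<lambda>z. l * I z)"
  proof (rule integral_dominated_convergence)
    show "integrable lborel (\<lambda>z. 16 * C * indicator (cbox (0, -1) (1, 0)) z :: real)"
      by (intro integrable_mult_right integrable_real_indicator)
        (auto simp: emeasure_lborel_cbox_eq)
    show "AE z in lborel. norm (H (c k) z) \<le> 16 * C * indicator (cbox (0, -1) (1, 0)) z" for k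
      using H_bound[OF c] by simp
  qed (use H_meas I_meas H_lim in auto)
  then have "(\<lambda>k. \<sigma> * integral\<^sup>L lborel (H (c k)) + 8 * e * (\<sigma> * c k))
      \<longlonglongrightarrow> \<sigma> * (l * integral\<^sup>L lborel I) + 8 * e * 0"
    by (intro tendsto_intros \<sigma>c_lim) simp
  then have "0 \<le> \<sigma> * (l * integral\<^sup>L lborel I) + 8 * e * 0"
    using key[OF c] by (intro LIMSEQ_le_const) auto
  then have "0 \<le> (\<sigma> * l) * integral\<^sup>L lborel I"
    by (simp add: mult.assoc)
  moreover have "0 < integral\<^sup>L lborel I"
  proof (rule ccontr)
    assume "\<not> 0 < integral\<^sup>L lborel I"
    then have "integral\<^sup>L lborel I = 0"
      using Bochner_Integration.integral_nonneg[of lborel I, OF I_nonneg] by linarith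
    then have AE: "AE z in lborel. I z = 0"
      using integral_nonneg_eq_0_iff_AE[OF I_int] I_nonneg by simp
    \<comment> \<open>Below \<open>t0\<close> both L t < 1 and t * t < 1 hold, so every factor of
      \<open>I\<close> is positive on the rectangle \<open>?U\<close>, whose measure is not
      zero.\<close>
    define t0 where "t0 = min 1 (1 / L)"
    let ?U = "{0<..<t0} \<times> {-1<..<0} :: (real \<times> real) set"
    have "I z \<noteq> 0" if "z \<in> ?U" for z
    proof -
      obtain t y where z: "z = (t, y)" "0 < t" "t < t0" "-1 < y" "y < 0"
        using \<open>z \<in> ?U\<close> by auto
      then have "L * t < 1" "t * t < 1"
        using \<open>0 < L\<close> mult_strict_mono[of t 1 t 1] by (auto simp: t0_def field_simps)
      then show ?thesis
        using z ramp_deriv_pos[of y] by (simp add: I_def pos_sq_def)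
    qed
    with AE have "AE z in lborel. z \<notin> ?U"
      by (auto elim: eventually_mono)
    moreover have "?U \<in> sets lborel"
      unfolding lborel_prod[symmetric] by (intro pair_measureI) auto
    ultimately have "emeasure lborel ?U = 0"
      using AE_iff_measurable[of ?U lborel "\<lambda>z. z \<notin> ?U"] by simp
    moreover have "emeasure lborel ?U = emeasure lborel {0<..<t0} * emeasure lborel {-1<..<0::real}"
      using lborel.emeasure_pair_measure_Times[of "{0<..<t0}" lborel "{-1<..<0::real}"]
      by (simp add: lborel_prod)
    moreover have "0 < t0"
      using \<open>0 < L\<close> by (simp add: t0_def)
    ultimately show False
      by simp
  qed
  ultimately show ?thesis
    by (simp add: zero_le_mult_iff)
qed

subsection \<open>Stationary states\<close>

text \<open>The sign \<open>\<tau>\<close> is chosen so that the entropy \<open>E\<close> vanishes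
  at \<open>r\<close>. The entropy of the datum then lives on the road only, and
  \<open>trace_flux_sign\<close> applies with cone speed \<open>L\<close>. Since
  \<open>k \<noteq> \<rho>\<close>, the entropy flux \<open>F\<close> is continuous at
  \<open>\<rho>\<close>, so its trace is \<open>F \<rho>\<close>, twice the Kruzkov flux.\<close>

lemma stationary_trace_strict:
  assumes sol: "weak_entropy_solution f (\<lambda>x. if \<sigma> * x < 0 then \<rho> else r) u"
    and lip: "\<And>v v'. \<bar>f v - f v'\<bar> \<le> L * \<bar>v - v'\<bar>" "0 < L" and f_bound: "\<And>v. \<bar>f v\<bar> \<le> C"
    and sg: "\<sigma> = 1 \<or> \<sigma> = - 1"
    and trace: "\<And>t. 0 < t \<Longrightarrow> (u t \<longlongrightarrow> \<rho>) (at 0 within {x. \<sigma> * x < 0})"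
    and k: "\<rho> < k \<and> k < r \<or> r < k \<and> k < \<rho>"
  shows "0 \<le> \<sigma> * kruzkov_flux f \<rho> k"
proof -
  define \<tau> :: real where "\<tau> = (if \<rho> < k then - 1 else 1)"
  define E where "E v = \<bar>v - k\<bar> + \<tau> * (v - k)" for v
  define F where "F v = kruzkov_flux f v k + \<tau> * (f v - f k)" for v
  define w where "w = (\<lambda>z. indicator ({0<..} \<times> UNIV) z * (case z of (t, x) \<Rightarrow> u t x))"
  have cont: "continuous_on UNIV f"
    using lip by (intro lipschitz_on_continuous_on[of L] lipschitz_onI) (auto simp: dist_real_def)
  have [measurable]: "f \<in> borel_measurable borel"
    using cont by (rule borel_measurable_continuous_onI)
  have w_meas: "w \<in> borel_measurable borel"
    using sol by (simp add: weak_entropy_solution_def set_borel_measurable_def w_def)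
  obtain B where B: "AE (t, x) in lborel. 0 < t \<longrightarrow> \<bar>u t x\<bar> \<le> B"
    using sol by (auto simp: weak_entropy_solution_def)
  have \<tau>: "\<tau> = 1 \<or> \<tau> = - 1"
    by (simp add: \<tau>_def)
  have E_bound: "\<bar>E v\<bar> \<le> 2 * (\<bar>v\<bar> + \<bar>k\<bar>)" for v
    using \<tau> by (auto simp: E_def)
  have "0 \<le> \<sigma> * F \<rho>"
  proof (rule trace_flux_sign[where E = E and F = F and w = w and L = L and \<sigma> = \<sigma> and C = "4 * C" and
        init = "\<lambda>x. E (if \<sigma> * x < 0 then \<rho> else r)" and e = "E \<rho>" and B = "2 * (\<bar>B\<bar> + \<bar>k\<bar>)"])
    have "AE z in lborel. \<bar>w z\<bar> \<le> \<bar>B\<bar>"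
      using B by eventually_elim (auto simp: w_def indicator_def)
    then show "AE z in lborel. \<bar>E (w z)\<bar> \<le> 2 * (\<bar>B\<bar> + \<bar>k\<bar>)"
      by eventually_elim (use E_bound in \<open>smt (verit)\<close>)
    show "E \<in> borel_measurable borel" "F \<in> borel_measurable borel"
      unfolding E_def F_def by measurable
    show E_nonneg: "0 \<le> E v" for v
      using \<tau> by (auto simp: E_def)
    show "0 \<le> E (if \<sigma> * x < 0 then \<rho> else r)" for x
      by (rule E_nonneg)
    \<comment> \<open>On the side of \<open>k\<close> where \<open>E\<close> vanishes, so does
      \<open>F\<close>. On the other side both are doubled, and the bound is the Lipschitz
      condition.\<close>
    show "\<bar>F v\<bar> \<le> L * E v" for v
    proof -
      consider "F v = 0" | "F v = 2 * (f v - f k) \<or> F v = - 2 * (f v - f k)" "E v = 2 * \<bar>v - k\<bar>"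
        using \<tau> by (cases v k rule: linorder_cases) (auto simp: F_def E_def kruzkov_flux_def)
      then show ?thesis
      proof cases
        case 1
        then show ?thesis
          using E_nonneg \<open>0 < L\<close> by simp
      next
        case 2
        then have "\<bar>F v\<bar> = 2 * \<bar>f v - f k\<bar>" by (smt (verit))
        then show ?thesis
          using lip(1)[of v k] 2 by simp
      qed
    qed
    show "\<bar>F v\<bar> \<le> 4 * C" for v
      using abs_kruzkov_flux_le[of f v k] f_bound[of v] f_bound[of k] \<tau> by (auto simp: F_def)
    show "E (if \<sigma> * x < 0 then \<rho> else r) = 0" if "0 \<le> \<sigma> * x" for x
      using that k by (auto simp: E_def \<tau>_def)
    show "E (if \<sigma> * x < 0 then \<rho> else r) \<le> E \<rho>" for x
      using k by (auto simp: E_def \<tau>_def)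
    show "((\<lambda>x. F (w (t, x))) \<longlongrightarrow> F \<rho>) (at 0 within {x. \<sigma> * x < 0})" if "0 < t" for t
    proof -
      have "(\<lambda>x. w (t, x)) = u t"
        using that by (simp add: w_def)
      moreover have "isCont f \<rho>"
        using cont by (simp add: continuous_on_eq_continuous_at)
      ultimately show ?thesis
        unfolding F_def kruzkov_flux_def using trace[OF that] k
        by (intro tendsto_intros isCont_tendsto_compose[of _ f]) auto
    qed
    show "0 \<le> (LINT (t, x):{0<..} \<times> UNIV|lborel. E (w (t, x)) * \<phi>t t x + F (w (t, x)) * \<phi>x t x)
        + (LINT x|lborel. E (if \<sigma> * x < 0 then \<rho> else r) * \<phi> 0 x)"
      if "test_function \<phi> \<phi>t \<phi>x" "\<And>t x. 0 \<le> \<phi> t x" for \<phi> \<phi>t \<phi>x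
      unfolding E_def F_def w_def
      by (rule semi_kruzkov_inequality[OF sol _ f_bound _ _ that, where K = "max \<bar>\<rho>\<bar> \<bar>r\<bar>"]) auto
  qed (use w_meas sg \<open>0 < L\<close> in auto)
  moreover have "F \<rho> = 2 * kruzkov_flux f \<rho> k"
    using k by (auto simp: F_def \<tau>_def kruzkov_flux_def)
  ultimately show ?thesis
    by simp
qed

section \<open>Admissible traces and the Godunov flux\<close>

text \<open>Unfolded, \<open>g \<rho>\<close> is the minimum of \<open>g\<close> over [\<rho>, r] if
  \<rho> \<le> r and the maximum over [r, \<rho>] otherwise: Godunov's formula with left state
  \<open>\<rho>\<close> and right state \<open>r\<close>. Outgoing roads fit in with
  \<open>g = - f\<close>, because reflecting \<open>x\<close> reverses the sign of the flux.\<close>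

definition admissible_trace :: "(real \<Rightarrow> real) \<Rightarrow> real \<Rightarrow> real \<Rightarrow> bool" where
  "admissible_trace g \<rho> r \<longleftrightarrow> (\<forall>k. min \<rho> r \<le> k \<longrightarrow> k \<le> max \<rho> r \<longrightarrow> 0 \<le> kruzkov_flux g \<rho> k)"

lemma kruzkov_flux_sym: "kruzkov_flux f p q = kruzkov_flux f q p"
  by (auto simp: kruzkov_flux_def sgn_if)

lemma kruzkov_flux_scale: "kruzkov_flux (\<lambda>v. c * f v) p q = c * kruzkov_flux f p q"
  by (simp add: kruzkov_flux_def algebra_simps)

text \<open>Values of \<open>k\<close> strictly between the two states are settled,
  \<open>k = \<rho>\<close> is trivial, and \<open>k = r\<close> follows by continuity of
  \<open>f\<close>.\<close>

lemma stationary_trace: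
  assumes sol: "weak_entropy_solution f (\<lambda>x. if \<sigma> * x < 0 then \<rho> else r) u"
    and lip: "\<And>v v'. \<bar>f v - f v'\<bar> \<le> L * \<bar>v - v'\<bar>" "0 < L" and f_bound: "\<And>v. \<bar>f v\<bar> \<le> C"
    and sg: "\<sigma> = 1 \<or> \<sigma> = - 1"
    and trace: "\<And>t. 0 < t \<Longrightarrow> (u t \<longlongrightarrow> \<rho>) (at 0 within {x. \<sigma> * x < 0})"
  shows "admissible_trace (\<lambda>v. \<sigma> * f v) \<rho> r"
  unfolding admissible_trace_def kruzkov_flux_scale
proof (intro allI impI)
  fix k assume k: "min \<rho> r \<le> k" "k \<le> max \<rho> r"
  have strict: "0 \<le> \<sigma> * kruzkov_flux f \<rho> k" if "\<rho> < k \<and> k < r \<or> r < k \<and> k < \<rho>" for k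
    using stationary_trace_strict[OF sol lip f_bound sg trace that] .
  consider "k = \<rho>" | "\<rho> < k \<and> k < r \<or> r < k \<and> k < \<rho>" | "k = r" "r \<noteq> \<rho>"
    using k by linarith
  then show "0 \<le> \<sigma> * kruzkov_flux f \<rho> k"
  proof cases
    case 1
    then show ?thesis by (simp add: kruzkov_flux_def)
  next
    case 2
    then show ?thesis by (rule strict)
  next
    case 3
    \<comment> \<open>The denominator starts at 2, since 1 would give \<open>c 0 = \<rho>\<close>,
      which is not strictly between the states.\<close>
    define c where "c j = r + (\<rho> - r) / real (Suc (Suc j))" for j
    have "c \<longlonglongrightarrow> r + 0"
      unfolding c_def by (intro tendsto_intros lim_const_over_n[THEN LIMSEQ_Suc, THEN LIMSEQ_Suc])
    moreover have "continuous_on UNIV f"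
      using lip by (intro lipschitz_on_continuous_on[of L] lipschitz_onI) (auto simp: dist_real_def)
    ultimately have "(\<lambda>j. \<sigma> * kruzkov_flux f \<rho> (c j)) \<longlonglongrightarrow> \<sigma> * kruzkov_flux f \<rho> r"
      unfolding kruzkov_flux_def using 3(2)
      by (intro tendsto_intros isCont_tendsto_compose[of _ f]) (auto simp: continuous_on_eq_continuous_at)
    moreover have "0 \<le> \<sigma> * kruzkov_flux f \<rho> (c j)" for j
    proof (rule strict)
      show "\<rho> < c j \<and> c j < r \<or> r < c j \<and> c j < \<rho>"
      proof (cases "\<rho> < r")
        case True
        then have "(r - \<rho>) * 1 < (r - \<rho>) * real (Suc (Suc j))"
          by (intro mult_strict_left_mono) auto
        then show ?thesis
          using True by (simp add: c_def field_simps)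
      next
        case False
        then have "(\<rho> - r) * 1 < (\<rho> - r) * real (Suc (Suc j))"
          using 3(2) by (intro mult_strict_left_mono) auto
        then show ?thesis
          using False 3(2) by (simp add: c_def field_simps)
      qed
    qed
    ultimately show ?thesis
      using 3(1) by (intro LIMSEQ_le_const) auto
  qed
qed

text \<open>The Godunov flux increases in the left and decreases in the right state. In each case
  there is a \<open>k\<close> with \<open>g q \<le> g k \<le> g p\<close>, namely \<open>q\<close>,
  \<open>p\<close> and \<open>s\<close> in turn: it lies in both [r, p] and [q, s], or coincides
  with \<open>q\<close> or \<open>p\<close> so that one of the inequalities is trivial.\<close>

lemma godunov_flux_mono:
  fixes g :: "real \<Rightarrow> real"
  assumes "admissible_trace g p r" and "admissible_trace g q s"
    and "q < p" and "r \<le> s"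
  shows "g q \<le> g p"
proof -
  have p: "g k \<le> g p" if "r \<le> k" "k \<le> p" for k
    using assms(1)[unfolded admissible_trace_def, rule_format, of k] that
    by (auto simp: kruzkov_flux_def sgn_if split: if_splits)
  have p': "g p \<le> g k" if "p \<le> k" "k \<le> r" for k
    using assms(1)[unfolded admissible_trace_def, rule_format, of k] that
    by (auto simp: kruzkov_flux_def sgn_if split: if_splits)
  have q: "g k \<le> g q" if "s \<le> k" "k \<le> q" for k
    using assms(2)[unfolded admissible_trace_def, rule_format, of k] that
    by (auto simp: kruzkov_flux_def sgn_if split: if_splits)
  have q': "g q \<le> g k" if "q \<le> k" "k \<le> s" for k
    using assms(2)[unfolded admissible_trace_def, rule_format, of k] that
    by (auto simp: kruzkov_flux_def sgn_if split: if_splits)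
  consider "s \<le> q" | "p \<le> s" | "q < s" "s < p"
    by linarith
  then show ?thesis
  proof cases
    case 1
    then show ?thesis using p[of q] assms by linarith
  next
    case 2
    then show ?thesis using q'[of p] assms by linarith
  next
    case 3
    then show ?thesis using p[of s] q'[of s] assms by linarith
  qed
qed

text \<open>As \<open>f\<close> vanishes at both end points, the extension equals \<open>f\<close>
  composed with the projection \<open>c\<close> onto [a, b], which is 1-Lipschitz. Comparison with
  \<open>f a = 0\<close> bounds it, and \<open>L + 1\<close> in place of \<open>L\<close> makes the
  constant positive.\<close>

lemma lipschitz_zero_extension:
  fixes f :: "real \<Rightarrow> real"
  assumes "a \<le> b" and "L-lipschitz_on {a..b} f" and "f a = 0" "f b = 0"
    and "\<And>x. x \<notin> {a..b} \<Longrightarrow> f x = 0"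
  obtains L' C where "\<And>v v'. \<bar>f v - f v'\<bar> \<le> L' * \<bar>v - v'\<bar>" and "0 < L'" and "\<And>v. \<bar>f v\<bar> \<le> C"
proof -
  define c where "c v = max a (min b v)" for v
  have c: "c v \<in> {a..b}" for v
    using assms(1) by (auto simp: c_def)
  have fc: "f v = f (c v)" for v
    using assms(1,3,4) assms(5)[of v] by (cases "v = b") (auto simp: c_def max_def min_def)
  have L: "0 \<le> L"
    using assms(2) by (rule lipschitz_on_nonneg)
  have lip: "\<bar>f v - f v'\<bar> \<le> L * \<bar>c v - c v'\<bar>" for v v'
    using lipschitz_onD[OF assms(2) c c, of v v'] by (simp add: fc[symmetric] dist_real_def)
  have "\<bar>f v - f v'\<bar> \<le> (L + 1) * \<bar>v - v'\<bar>" for v v'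
  proof -
    have "L * \<bar>c v - c v'\<bar> \<le> (L + 1) * \<bar>v - v'\<bar>"
      using L by (intro mult_mono) (auto simp: c_def)
    then show ?thesis using lip[of v v'] by linarith
  qed
  moreover have "\<bar>f v\<bar> \<le> L * (b - a)" for v
  proof -
    have "L * \<bar>c v - c a\<bar> \<le> L * (b - a)"
      using L assms(1) by (intro mult_left_mono) (auto simp: c_def)
    then show ?thesis using lip[of v a] assms(3) by linarith
  qed
  ultimately show thesis
    using L by (intro that[of "L + 1"]) auto
qed

section \<open>Signed roads and summation over the junction\<close>

definition road_sign :: "nat \<Rightarrow> nat \<Rightarrow> real" where
  "road_sign n h = (if h \<le> n then 1 else - 1)"

lemma mem_road_iff: "x \<in> road n h \<longleftrightarrow> road_sign n h * x < 0"
  by (auto simp: road_def road_sign_def)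

lemma sum_road_sign:
  "(\<Sum>h=1..n+m. road_sign n h * F h) = (\<Sum>i=1..n. F i) - (\<Sum>j=n+1..n+m. F j)"
proof -
  have "{1..n+m} = {1..n} \<union> {n+1..n+m}" by auto
  then have "(\<Sum>h=1..n+m. road_sign n h * F h)
      = (\<Sum>h=1..n. road_sign n h * F h) + (\<Sum>h=n+1..n+m. road_sign n h * F h)"
    by (simp add: sum.union_disjoint)
  also have "\<dots> = (\<Sum>i=1..n. F i) - (\<Sum>j=n+1..n+m. F j)"
    by (simp add: road_sign_def sum_negf)
  finally show ?thesis .
qed

text \<open>At a fixed point the trace on each road equals the initial state there, so
  \<open>stationary_trace\<close> applies road by road. The pair of \<open>M\<close> and
  \<open>z\<close> is common to all roads, which is what allows two fixed points to be compared on
  all of them at once.\<close>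

lemma riemann_solver_stationary:
  assumes "riemann_solver n m f P \<rho> \<rho>"
    and "\<And>h. h \<in> {1..n+m} \<Longrightarrow> a h \<le> b h"
    and "\<And>h. h \<in> {1..n+m} \<Longrightarrow> \<exists>L. L-lipschitz_on {a h..b h} (f h)"
    and "\<And>h. h \<in> {1..n+m} \<Longrightarrow> f h (a h) = 0 \<and> f h (b h) = 0"
    and "\<And>h x. h \<in> {1..n+m} \<Longrightarrow> x \<notin> {a h..b h} \<Longrightarrow> f h x = 0"
  shows "\<exists>M. \<exists>z\<in>{0..1}.
    (\<forall>h\<in>{1..n+m}. admissible_trace (\<lambda>v. road_sign n h * f h v) (\<rho> h) (P M h z)) \<and>
    (\<Sum>h=1..n+m. road_sign n h * f h (\<rho> h)) = 0"
proof -
  obtain M z u where z: "z \<in> {0..1}"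
    and sol: "\<And>h. h \<in> {1..n+m} \<Longrightarrow>
        weak_entropy_solution (f h) (\<lambda>x. if x \<in> road n h then \<rho> h else P M h z) (u h)"
    and trace: "\<And>h t. h \<in> {1..n+m} \<Longrightarrow> 0 < t \<Longrightarrow> (u h t \<longlongrightarrow> \<rho> h) (at 0 within road n h)"
    and bal: "(\<Sum>i=1..n. f i (\<rho> i)) - (\<Sum>j=n+1..n+m. f j (\<rho> j)) = 0"
    using assms(1) unfolding riemann_solver_def by blast
  have road: "road n h = {x. road_sign n h * x < 0}" for h
    by (auto simp: mem_road_iff)
  have "admissible_trace (\<lambda>v. road_sign n h * f h v) (\<rho> h) (P M h z)"
    if h: "h \<in> {1..n+m}" for h
  proof -
    obtain L where "L-lipschitz_on {a h..b h} (f h)"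
      using assms(3) h by blast
    then obtain L' C where lip: "\<And>v v'. \<bar>f h v - f h v'\<bar> \<le> L' * \<bar>v - v'\<bar>" "0 < L'" "\<And>v. \<bar>f h v\<bar> \<le> C"
      using lipschitz_zero_extension[where f = "f h" and a = "a h" and b = "b h"] assms(2,4,5) h by metis
    show ?thesis
    proof (rule stationary_trace[OF _ lip])
      show "weak_entropy_solution (f h) (\<lambda>x. if road_sign n h * x < 0 then \<rho> h else P M h z) (u h)"
        using sol[OF h] by (simp add: mem_road_iff)
      show "(u h t \<longlongrightarrow> \<rho> h) (at 0 within {x. road_sign n h * x < 0})" if "0 < t" for t
        using trace[OF h that] by (simp add: road)
    qed (simp add: road_sign_def)
  qed
  moreover have "(\<Sum>h=1..n+m. road_sign n h * f h (\<rho> h)) = 0"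
    using bal by (simp only: sum_road_sign)
  ultimately show ?thesis
    using z by blast
qed

text \<open>For \<open>p \<le> q\<close> this is an equality. For \<open>p > q\<close> the left-hand
  side is nonpositive and the right-hand side nonnegative by monotonicity of the Godunov
  flux.\<close>

lemma kruzkov_flux_ge:
  assumes "admissible_trace g p r" and "admissible_trace g q s" and "r \<le> s"
  shows "g q - g p \<le> kruzkov_flux g p q"
  using godunov_flux_mono[OF assms(1,2) _ assms(3)]
  by (cases p q rule: linorder_cases) (auto simp: kruzkov_flux_def)

theorem proposition2:
  fixes n m :: nat
    and a b :: "nat \<Rightarrow> real"
    and f \<eta> :: "nat \<Rightarrow> real \<Rightarrow> real"
    and P :: "real \<Rightarrow> nat \<Rightarrow> real \<Rightarrow> real"
    and \<rho>1 \<rho>2 :: "nat \<Rightarrow> real"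
  assumes "n \<ge> 1" and "m \<ge> 1"
    and "\<And>h. h \<in> {1..n+m} \<Longrightarrow> a h \<le> b h"
    and "\<And>h. h \<in> {1..n+m} \<Longrightarrow> \<exists>L. L-lipschitz_on {a h..b h} (f h)"
    and "\<And>h. h \<in> {1..n+m} \<Longrightarrow> concave_on {a h..b h} (f h)"
    and "\<And>h x. h \<in> {1..n+m} \<Longrightarrow> x \<in> {a h..b h} \<Longrightarrow> f h x \<ge> 0"
    and "\<And>h. h \<in> {1..n+m} \<Longrightarrow> f h (a h) = 0 \<and> f h (b h) = 0"
    and "\<And>h x. h \<in> {1..n+m} \<Longrightarrow> x \<notin> {a h..b h} \<Longrightarrow> f h x = 0"
    and "(\<Sum>i=1..n. f i 0) - (\<Sum>j=n+1..n+m. f j 0) = 0"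
    and "\<And>h. h \<in> {1..n+m} \<Longrightarrow> convex_on UNIV (\<eta> h)"
    and "priority_functions (n + m) a b \<eta> P"
    and "\<And>h. h \<in> {1..n+m} \<Longrightarrow> \<rho>1 h \<in> {a h..b h}"
    and "\<And>h. h \<in> {1..n+m} \<Longrightarrow> \<rho>2 h \<in> {a h..b h}"
    and "riemann_solver n m f P \<rho>1 \<rho>1"
    and "riemann_solver n m f P \<rho>2 \<rho>2"
  shows "(\<Sum>i=1..n. kruzkov_flux (f i) (\<rho>1 i) (\<rho>2 i))
         - (\<Sum>j=n+1..n+m. kruzkov_flux (f j) (\<rho>1 j) (\<rho>2 j)) \<ge> 0"
proof -
  let ?g = "\<lambda>h v. road_sign n h * f h v"
  have "\<exists>M. \<exists>z\<in>{0..1}. (\<forall>h\<in>{1..n+m}. admissible_trace (?g h) (\<rho>1 h) (P M h z)) \<and>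
      (\<Sum>h=1..n+m. ?g h (\<rho>1 h)) = 0"
    by (rule riemann_solver_stationary[OF assms(14,3,4,7,8)])
  then obtain M1 z1 where z1: "z1 \<in> {0..1}"
    and adm1: "\<And>h. h \<in> {1..n+m} \<Longrightarrow> admissible_trace (?g h) (\<rho>1 h) (P M1 h z1)"
    and bal1: "(\<Sum>h=1..n+m. ?g h (\<rho>1 h)) = 0"
    by blast
  have "\<exists>M. \<exists>z\<in>{0..1}. (\<forall>h\<in>{1..n+m}. admissible_trace (?g h) (\<rho>2 h) (P M h z)) \<and>
      (\<Sum>h=1..n+m. ?g h (\<rho>2 h)) = 0"
    by (rule riemann_solver_stationary[OF assms(15,3,4,7,8)])
  then obtain M2 z2 where z2: "z2 \<in> {0..1}"
    and adm2: "\<And>h. h \<in> {1..n+m} \<Longrightarrow> admissible_trace (?g h) (\<rho>2 h) (P M2 h z2)"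
    and bal2: "(\<Sum>h=1..n+m. ?g h (\<rho>2 h)) = 0"
    by blast
  note mono = priority_functions_mono[OF assms(11,10)]
  have "0 \<le> (\<Sum>h=1..n+m. kruzkov_flux (?g h) (\<rho>1 h) (\<rho>2 h))"
  \<comment> \<open>The lexicographic order is total, so one family of prescribed states lies below
    the other on every road. The second case exchanges the two solutions and uses the symmetry of
    the Kruzkov flux.\<close>
  proof (cases "M1 < M2 \<or> M1 = M2 \<and> z1 \<le> z2")
    case True
    have "(\<Sum>h=1..n+m. ?g h (\<rho>2 h) - ?g h (\<rho>1 h)) \<le> (\<Sum>h=1..n+m. kruzkov_flux (?g h) (\<rho>1 h) (\<rho>2 h))"
      by (intro sum_mono kruzkov_flux_ge[OF adm1 adm2 mono[OF _ z1 z2 True]])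
    then show ?thesis
      by (simp only: sum_subtractf bal1 bal2 diff_self)
  next
    case False
    then have less: "M2 < M1 \<or> M2 = M1 \<and> z2 \<le> z1"
      by auto
    have "(\<Sum>h=1..n+m. ?g h (\<rho>1 h) - ?g h (\<rho>2 h)) \<le> (\<Sum>h=1..n+m. kruzkov_flux (?g h) (\<rho>2 h) (\<rho>1 h))"
      by (intro sum_mono kruzkov_flux_ge[OF adm2 adm1 mono[OF _ z2 z1 less]])
    then show ?thesis
      by (simp only: sum_subtractf bal1 bal2 diff_self kruzkov_flux_sym[of "?g h" "\<rho>2 h" for h])
  qed
  then show ?thesis
    by (simp only: kruzkov_flux_scale sum_road_sign)
qed

end
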